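(* Let $Q$ be a manifold, $\psi:\mathbb{R}^{+}\times Q\to Q$ a principal action of the multiplicative group of positive reals with projection $\pi:Q\to Q/\mathbb{R}^{+}$, let $L:TQ\to\mathbb{R}$ be a smooth function that is homogeneous of degree $1$ with respect to the tangent lift of $\psi$, let $f:Q\to\mathbb{R}^{+}$ be a scaling function, and let $\ell:T(Q/\mathbb{R}^{+})\times\mathbb{R}\to\mathbb{R}$ be the corresponding reduced Lagrangian. Let $\tau>0$, and let $\gamma:[0,\tau]\to Q$, $x:[0,\tau]\to Q/\mathbb{R}^{+}$, $y:[0,\tau]\to\mathbb{R}$ be smooth curves and $\varsigma\in\mathbb{R}^{+}$ a number such that $\gamma,x,y,\varsigma$ are interrelated. Then $\gamma$ is a critical point of the functional $$A(\gamma)=\int_{0}^{\tau}L(\dot\gamma(t))\,dt$$ with respect to variations $\delta\gamma$ such that $\delta\gamma(0)$ and $\delta\gamma(\tau)$ are zero vectors, if and only if $(x,y)$ is a critical point of the functional $$\check A(x,y)=\int_{0}^{\tau}\exp\left(\int_{0}^{t}y(s)\,ds\right)\ell(\dot x(t),y(t))\,dt$$ with respect to variations $(\delta x,\delta y)$ such that $\delta x(0)$ and $\delta x(\tau)$ are zero vectors and $\int_{0}^{\tau}\delta y(s)\,ds=0$.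
   Context: All manifolds are finite-dimensional and all objects are $C^\infty$. $\mathbb{R}^+$ is the multiplicative group of positive reals. A principal action $\psi:\mathbb{R}^{+}\times Q\to Q$ is a smooth action such that the canonical projection $\pi:Q\to Q/\mathbb{R}^{+}$ is a principal bundle. $L:TQ\to\mathbb{R}$ is homogeneous of degree 1 if $L((\psi_\varsigma)_{*,q}(v))=\varsigma L(v)$ for all $\varsigma\in\mathbb{R}^+$, $q\in Q$, $v\in T_qQ$ ($L$ is not assumed regular). A scaling function is a smooth $f:Q\to\mathbb{R}^+$ with $f(\psi_\varsigma(q))=\varsigma f(q)$ for all $\varsigma,q$. Then $(\pi,f):Q\to (Q/\mathbb{R}^+)\times\mathbb{R}^+$ is a diffeomorphism (global trivialization). Reduced Lagrangian: let $p:TQ\to TQ/\mathbb{R}^+$ be the projection for the tangent lift of $\psi$, and let $\alpha_f:TQ/\mathbb{R}^+\to T(Q/\mathbb{R}^+)\times\mathbb{R}$ be the diffeomorphism $\alpha_f(p(v_q))=(\pi_*(v_q),\,df(v_q)/f(q))$ for $v_q\in T_qQ$. The reduced Lagrangian $\ell:T(Q/\mathbb{R}^+)\times\mathbb{R}\to\mathbb{R}$ is the unique function with $\ell(\alpha_f(p(v_q)))=L(v_q)/f(q)$ for all $v_q\in T_qQ$ and $q\in Q$. Interrelated: $\gamma,x,y,\varsigma$ are interrelated if $x(t)=\pi(\gamma(t))$, $y(t)=d(\ln f)(\dot\gamma(t))$ for all $t\in[0,\tau]$, and $\varsigma=f(\gamma(0))$; equivalently, $\gamma(t)=\psi\left(e^{\int_0^t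 y(s)ds},(\pi,f)^{-1}(x(t),\varsigma)\right)$ for all $t\in[0,\tau]$. Variations: for a curve $c:[0,\tau]\to M$, a variation of $c$ is a smooth curve $\delta c:[0,\tau]\to TM$ with $\delta c(t)\in T_{c(t)}M$; it can be written $\delta c(t)=\frac{\partial}{\partial s}|_{s=0}\Gamma(s,t)$ for some smooth $\Gamma:(-\epsilon,\epsilon)\times[0,\tau]\to M$ with $\Gamma(0,\cdot)=c$. For a functional $\mathfrak{F}$ on smooth curves, $\delta\mathfrak{F}(c)=\frac{\partial}{\partial s}|_{s=0}\mathfrak{F}(\Gamma(s,\cdot))$ (for the functionals considered this depends only on $\delta c$), and $c$ is a critical point of $\mathfrak{F}$ with respect to a set $\mathcal V$ of variations if $\delta\mathfrak{F}(c)=0$ for all $\delta c\in\mathcal V$. Variations of the curve $(x,y)$ in $(Q/\mathbb{R}^+)\times\mathbb{R}$ are pairs $(\delta x,\delta y)$, where $\delta y$ is identified with a function $[0,\tau]\to\mathbb{R}$. *)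

theory Defs
  imports "HOL-Analysis.Analysis"
begin

section \<open>Smooth functions on subsets of Euclidean spaces\<close>

primrec times_continuously_differentiable_on ::
  "nat \<Rightarrow> 'a::euclidean_space set \<Rightarrow> ('a \<Rightarrow> 'b::euclidean_space) \<Rightarrow> bool" where
  "times_continuously_differentiable_on 0 U g \<longleftrightarrow> continuous_on U g"
| "times_continuously_differentiable_on (Suc k) U g \<longleftrightarrow>
     (\<forall>x\<in>U. g differentiable (at x)) \<and>
     (\<forall>v. times_continuously_differentiable_on k U (\<lambda>x. frechet_derivative g (at x) v))"

text \<open>On an arbitrary set (a closed interval, or a relatively open subset of a linear subspace),
  a function is smooth if it extends smoothly to an open neighbourhood of each point.\<close>

definition smooth_on :: "'a::euclidean_space set \<Rightarrow> ('a \<Rightarrow> 'b::euclidean_space) \<Rightarrow> bool" where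
  "smooth_on S g \<longleftrightarrow>
     (\<forall>x\<in>S. \<exists>U G. open U \<and> x \<in> U \<and> (\<forall>k. times_continuously_differentiable_on k U G) \<and>
        (\<forall>y\<in>S \<inter> U. G y = g y))"

section \<open>Manifolds and smooth maps\<close>

text \<open>A manifold is given by an atlas of charts \<open>(U, \<phi>)\<close> with values in a linear subspace
  \<open>model\<close> of a Euclidean space. The dimension of the manifold is the dimension of that subspace;
  in this way dimension 0 is not excluded. The value of \<open>\<phi>\<close> outside \<open>U\<close> is irrelevant.\<close>

record ('p, 'e) manifold =
  model :: "'e set"
  atlas :: "('p set \<times> ('p \<Rightarrow> 'e)) set"

definition points :: "('p, 'e) manifold \<Rightarrow> 'p set" where
  "points M = (\<Union>(U, \<phi>)\<in>atlas M. U)"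

definition mtop :: "('p, 'e::euclidean_space) manifold \<Rightarrow> 'p topology" where
  "mtop M = topology_generated_by {U \<inter> \<phi> -` W | U \<phi> W. (U, \<phi>) \<in> atlas M \<and> open W}"

definition smooth_manifold :: "('p, 'e::euclidean_space) manifold \<Rightarrow> bool" where
  "smooth_manifold M \<longleftrightarrow>
     subspace (model M) \<and>
     (\<forall>(U, \<phi>)\<in>atlas M. inj_on \<phi> U) \<and>
     (\<forall>(U, \<phi>)\<in>atlas M. \<forall>(V, \<eta>)\<in>atlas M.
        openin (top_of_set (model M)) (\<phi> ` (U \<inter> V)) \<and>
        smooth_on (\<phi> ` (U \<inter> V)) (\<eta> \<circ> inv_into U \<phi>)) \<and>
     Hausdorff_space (mtop M) \<and> second_countable (mtop M)"

text \<open>Smoothness of \<open>F\<close> on an arbitrary subset \<open>S\<close> of the points of \<open>M\<close>.\<close>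

definition smooth_map_on ::
  "('p, 'e::euclidean_space) manifold \<Rightarrow> 'p set \<Rightarrow> ('q, 'f::euclidean_space) manifold \<Rightarrow> ('p \<Rightarrow> 'q) \<Rightarrow> bool"
  where
  "smooth_map_on M S N F \<longleftrightarrow>
     S \<subseteq> points M \<and>
     (\<forall>p\<in>S. \<exists>(U, \<phi>)\<in>atlas M. \<exists>(V, \<eta>)\<in>atlas N. \<exists>W.
        openin (mtop M) W \<and> p \<in> W \<and> W \<subseteq> U \<and> F ` (W \<inter> S) \<subseteq> V \<and>
        smooth_on (\<phi> ` (W \<inter> S)) (\<eta> \<circ> F \<circ> inv_into U \<phi>))"

definition diffeomorphism_on ::
  "('p, 'e::euclidean_space) manifold \<Rightarrow> 'p set \<Rightarrow> ('q, 'f::euclidean_space) manifold \<Rightarrow> 'q set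
     \<Rightarrow> ('p \<Rightarrow> 'q) \<Rightarrow> bool" where
  "diffeomorphism_on M S N T F \<longleftrightarrow>
     bij_betw F S T \<and> smooth_map_on M S N F \<and> smooth_map_on N T M (inv_into S F)"

definition euclidean_manifold :: "('a::euclidean_space, 'a) manifold" where
  "euclidean_manifold = \<lparr>model = UNIV, atlas = {(UNIV, id)}\<rparr>"

definition product_manifold ::
  "('p, 'e::euclidean_space) manifold \<Rightarrow> ('q, 'f::euclidean_space) manifold \<Rightarrow> ('p \<times> 'q, 'e \<times> 'f) manifold"
  where
  "product_manifold M N =
     \<lparr>model = model M \<times> model N,
      atlas = {(U \<times> V, map_prod \<phi> \<eta>) | U \<phi> V \<eta>. (U, \<phi>) \<in> atlas M \<and> (V, \<eta>) \<in> atlas N}\<rparr>"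

section \<open>Tangent vectors\<close>

text \<open>A tangent vector at \<open>q\<close> is a pair \<open>(q, D)\<close> where \<open>D\<close> is a derivation on the functions that are
  smooth near \<open>q\<close>. To make \<open>D\<close> unique as a HOL function, it is 0 on all other functions.\<close>

type_synonym 'p tangent_vector = "'p \<times> (('p \<Rightarrow> real) \<Rightarrow> real)"

definition smooth_near :: "('p, 'e::euclidean_space) manifold \<Rightarrow> 'p \<Rightarrow> ('p \<Rightarrow> real) set" where
  "smooth_near M q =
     {g. \<exists>W. openin (mtop M) W \<and> q \<in> W \<and> smooth_map_on M W euclidean_manifold g}"

definition tangent_space :: "('p, 'e::euclidean_space) manifold \<Rightarrow> 'p \<Rightarrow> 'p tangent_vector set" where
  "tangent_space M q =
     {(q, D) | D.
        (\<forall>g\<in>smooth_near M q. \<forall>h\<in>smooth_near M q. \<forall>a b.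
           D (\<lambda>p. a * g p + b * h p) = a * D g + b * D h) \<and>
        (\<forall>g\<in>smooth_near M q. \<forall>h\<in>smooth_near M q.
           D (\<lambda>p. g p * h p) = g q * D h + h q * D g) \<and>
        (\<forall>g. g \<notin> smooth_near M q \<longrightarrow> D g = 0)}"

definition zero_vector :: "'p \<Rightarrow> 'p tangent_vector" where
  "zero_vector q = (q, \<lambda>g. 0)"

definition tangent_vectors :: "('p, 'e::euclidean_space) manifold \<Rightarrow> 'p tangent_vector set" where
  "tangent_vectors M = (\<Union>q\<in>points M. tangent_space M q)"

text \<open>The chart \<open>(U, \<phi>)\<close> of \<open>M\<close> induces the chart \<open>(q, D) \<mapsto> (\<phi> q, (D \<phi>\<^sub>1, \<dots>, D \<phi>\<^sub>n))\<close> of the tangent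
  bundle, \<open>\<phi>\<^sub>i\<close> being the components of \<open>\<phi>\<close>.\<close>

definition tangent_bundle ::
  "('p, 'e::euclidean_space) manifold \<Rightarrow> ('p tangent_vector, 'e \<times> 'e) manifold" where
  "tangent_bundle M =
     \<lparr>model = model M \<times> model M,
      atlas = {({v \<in> tangent_vectors M. fst v \<in> U},
                \<lambda>v. (\<phi> (fst v), \<Sum>b\<in>Basis. snd v (\<lambda>p. \<phi> p \<bullet> b) *\<^sub>R b)) | U \<phi>. (U, \<phi>) \<in> atlas M}\<rparr>"

definition pushforward ::
  "('p, 'e::euclidean_space) manifold \<Rightarrow> ('q, 'f::euclidean_space) manifold \<Rightarrow> ('p \<Rightarrow> 'q)
     \<Rightarrow> 'p tangent_vector \<Rightarrow> 'q tangent_vector" where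
  "pushforward M N F v =
     (F (fst v), \<lambda>g. if g \<in> smooth_near N (F (fst v)) then snd v (g \<circ> F) else 0)"

definition differential :: "('p \<Rightarrow> real) \<Rightarrow> 'p tangent_vector \<Rightarrow> real" where
  "differential g v = snd v g"

text \<open>The velocity at time \<open>t\<close> of a curve \<open>c\<close> defined on the interval \<open>I\<close>; it is a one-sided
  derivative at an end point of \<open>I\<close>.\<close>

definition velocity ::
  "('p, 'e::euclidean_space) manifold \<Rightarrow> real set \<Rightarrow> (real \<Rightarrow> 'p) \<Rightarrow> real \<Rightarrow> 'p tangent_vector" where
  "velocity M I c t =
     (c t, \<lambda>g. if g \<in> smooth_near M (c t) then vector_derivative (g \<circ> c) (at t within I) else 0)"

section \<open>Variations and critical points\<close>

definition smooth_curve ::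
  "('p, 'e::euclidean_space) manifold \<Rightarrow> real \<Rightarrow> (real \<Rightarrow> 'p) \<Rightarrow> bool" where
  "smooth_curve M \<tau> c \<longleftrightarrow> smooth_map_on euclidean_manifold {0..\<tau>} M c"

definition variation ::
  "('p, 'e::euclidean_space) manifold \<Rightarrow> real \<Rightarrow> (real \<Rightarrow> 'p) \<Rightarrow> (real \<Rightarrow> 'p tangent_vector) \<Rightarrow> bool" where
  "variation M \<tau> c \<delta>c \<longleftrightarrow>
     smooth_curve (tangent_bundle M) \<tau> \<delta>c \<and> (\<forall>t\<in>{0..\<tau>}. \<delta>c t \<in> tangent_space M (c t))"

definition generates_variation ::
  "('p, 'e::euclidean_space) manifold \<Rightarrow> real \<Rightarrow> (real \<Rightarrow> 'p) \<Rightarrow> (real \<Rightarrow> 'p tangent_vector)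
     \<Rightarrow> real \<Rightarrow> (real \<Rightarrow> real \<Rightarrow> 'p) \<Rightarrow> bool" where
  "generates_variation M \<tau> c \<delta>c \<epsilon> \<Gamma> \<longleftrightarrow>
     \<epsilon> > 0 \<and>
     smooth_map_on euclidean_manifold ({-\<epsilon><..<\<epsilon>} \<times> {0..\<tau>}) M (\<lambda>(s, t). \<Gamma> s t) \<and>
     (\<forall>t\<in>{0..\<tau>}. \<Gamma> 0 t = c t) \<and>
     (\<forall>t\<in>{0..\<tau>}. velocity M {-\<epsilon><..<\<epsilon>} (\<lambda>s. \<Gamma> s t) 0 = \<delta>c t)"

text \<open>\<open>\<delta>F(c) = d\<close> for the variation \<open>\<delta>c\<close>, whatever family \<open>\<Gamma>\<close> is used to represent \<open>\<delta>c\<close>.\<close>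

definition has_first_variation ::
  "('p, 'e::euclidean_space) manifold \<Rightarrow> real \<Rightarrow> ((real \<Rightarrow> 'p) \<Rightarrow> real) \<Rightarrow> (real \<Rightarrow> 'p)
     \<Rightarrow> (real \<Rightarrow> 'p tangent_vector) \<Rightarrow> real \<Rightarrow> bool" where
  "has_first_variation M \<tau> F c \<delta>c d \<longleftrightarrow>
     (\<forall>\<epsilon> \<Gamma>. generates_variation M \<tau> c \<delta>c \<epsilon> \<Gamma> \<longrightarrow> ((\<lambda>s. F (\<Gamma> s)) has_real_derivative d) (at 0))"

definition critical_point ::
  "('p, 'e::euclidean_space) manifold \<Rightarrow> real \<Rightarrow> ((real \<Rightarrow> 'p) \<Rightarrow> real) \<Rightarrow> (real \<Rightarrow> 'p)
     \<Rightarrow> (real \<Rightarrow> 'p tangent_vector) set \<Rightarrow> bool" where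
  "critical_point M \<tau> F c \<V> \<longleftrightarrow> (\<forall>\<delta>c\<in>\<V>. has_first_variation M \<tau> F c \<delta>c 0)"

section \<open>Principal actions of the multiplicative group of positive reals\<close>

definition orbit :: "(real \<Rightarrow> 'p \<Rightarrow> 'p) \<Rightarrow> 'p \<Rightarrow> 'p set" where
  "orbit \<psi> q = {\<psi> \<sigma> q | \<sigma>. \<sigma> > 0}"

definition smooth_action :: "('q, 'e::euclidean_space) manifold \<Rightarrow> (real \<Rightarrow> 'q \<Rightarrow> 'q) \<Rightarrow> bool" where
  "smooth_action Q \<psi> \<longleftrightarrow>
     (\<forall>\<sigma>>0. \<forall>q\<in>points Q. \<psi> \<sigma> q \<in> points Q) \<and>
     (\<forall>q\<in>points Q. \<psi> 1 q = q) \<and>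
     (\<forall>\<sigma>>0. \<forall>\<rho>>0. \<forall>q\<in>points Q. \<psi> \<sigma> (\<psi> \<rho> q) = \<psi> (\<sigma> * \<rho>) q) \<and>
     smooth_map_on (product_manifold euclidean_manifold Q) ({0<..} \<times> points Q) Q (\<lambda>(\<sigma>, q). \<psi> \<sigma> q)"

text \<open>The action \<open>\<psi>\<close> is smooth, and \<open>B\<close> is the set of orbits, with a manifold structure for which the
  projection \<open>orbit \<psi>\<close> is a principal bundle: it has equivariant local trivializations
  \<open>q \<mapsto> (orbit \<psi> q, h q)\<close>. There is at most one such manifold structure on the set of orbits (up to
  equivalence of atlases).\<close>

definition principal_action ::
  "('q, 'e::euclidean_space) manifold \<Rightarrow> (real \<Rightarrow> 'q \<Rightarrow> 'q) \<Rightarrow> ('q set, 'f::euclidean_space) manifold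
     \<Rightarrow> bool" where
  "principal_action Q \<psi> B \<longleftrightarrow>
     smooth_action Q \<psi> \<and>
     smooth_manifold B \<and> points B = orbit \<psi> ` points Q \<and>
     smooth_map_on Q (points Q) B (orbit \<psi>) \<and>
     (\<forall>b\<in>points B. \<exists>U h. openin (mtop B) U \<and> b \<in> U \<and>
        (\<forall>q\<in>points Q. orbit \<psi> q \<in> U \<longrightarrow> (\<forall>\<sigma>>0. h (\<psi> \<sigma> q) = \<sigma> * h q)) \<and>
        diffeomorphism_on Q {q \<in> points Q. orbit \<psi> q \<in> U}
          (product_manifold B euclidean_manifold) (U \<times> {0<..}) (\<lambda>q. (orbit \<psi> q, h q :: real)))"

definition tangent_lift ::
  "('q, 'e::euclidean_space) manifold \<Rightarrow> (real \<Rightarrow> 'q \<Rightarrow> 'q) \<Rightarrow> real \<Rightarrow> 'q tangent_vector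
     \<Rightarrow> 'q tangent_vector" where
  "tangent_lift Q \<psi> \<sigma> = pushforward Q Q (\<psi> \<sigma>)"

definition homogeneous_lagrangian ::
  "('q, 'e::euclidean_space) manifold \<Rightarrow> (real \<Rightarrow> 'q \<Rightarrow> 'q) \<Rightarrow> ('q tangent_vector \<Rightarrow> real) \<Rightarrow> bool" where
  "homogeneous_lagrangian Q \<psi> L \<longleftrightarrow>
     (\<forall>\<sigma>>0. \<forall>v\<in>tangent_vectors Q. L (tangent_lift Q \<psi> \<sigma> v) = \<sigma> * L v)"

definition scaling_function ::
  "('q, 'e::euclidean_space) manifold \<Rightarrow> (real \<Rightarrow> 'q \<Rightarrow> 'q) \<Rightarrow> ('q \<Rightarrow> real) \<Rightarrow> bool" where
  "scaling_function Q \<psi> f \<longleftrightarrow>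
     smooth_map_on Q (points Q) euclidean_manifold f \<and>
     (\<forall>q\<in>points Q. f q > 0) \<and>
     (\<forall>\<sigma>>0. \<forall>q\<in>points Q. f (\<psi> \<sigma> q) = \<sigma> * f q)"

section \<open>Reduced Lagrangian and the two functionals\<close>

text \<open>The map \<open>\<alpha>\<^sub>f\<close> on the orbits \<open>w\<close> of the tangent lift; the pair below is the same for all
  \<open>v \<in> w\<close>.\<close>

definition alpha ::
  "('q, 'e::euclidean_space) manifold \<Rightarrow> (real \<Rightarrow> 'q \<Rightarrow> 'q) \<Rightarrow> ('q set, 'f::euclidean_space) manifold
     \<Rightarrow> ('q \<Rightarrow> real) \<Rightarrow> 'q tangent_vector set \<Rightarrow> 'q set tangent_vector \<times> real" where
  "alpha Q \<psi> B f w =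
     (THE u. \<forall>v\<in>w. u = (pushforward Q B (orbit \<psi>) v, differential f v / f (fst v)))"

definition reduced_lagrangian ::
  "('q, 'e::euclidean_space) manifold \<Rightarrow> (real \<Rightarrow> 'q \<Rightarrow> 'q) \<Rightarrow> ('q set, 'f::euclidean_space) manifold
     \<Rightarrow> ('q \<Rightarrow> real) \<Rightarrow> ('q tangent_vector \<Rightarrow> real) \<Rightarrow> ('q set tangent_vector \<times> real \<Rightarrow> real) \<Rightarrow> bool" where
  "reduced_lagrangian Q \<psi> B f L l \<longleftrightarrow>
     (\<forall>v\<in>tangent_vectors Q. l (alpha Q \<psi> B f (orbit (tangent_lift Q \<psi>) v)) = L v / f (fst v))"

definition interrelated ::
  "('q, 'e::euclidean_space) manifold \<Rightarrow> (real \<Rightarrow> 'q \<Rightarrow> 'q) \<Rightarrow> ('q \<Rightarrow> real) \<Rightarrow> real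
     \<Rightarrow> (real \<Rightarrow> 'q) \<Rightarrow> (real \<Rightarrow> 'q set) \<Rightarrow> (real \<Rightarrow> real) \<Rightarrow> real \<Rightarrow> bool" where
  "interrelated Q \<psi> f \<tau> \<gamma> x y \<sigma> \<longleftrightarrow>
     (\<forall>t\<in>{0..\<tau>}. x t = orbit \<psi> (\<gamma> t) \<and>
        y t = differential (\<lambda>q. ln (f q)) (velocity Q {0..\<tau>} \<gamma> t)) \<and>
     \<sigma> = f (\<gamma> 0)"

definition action_functional ::
  "('q, 'e::euclidean_space) manifold \<Rightarrow> ('q tangent_vector \<Rightarrow> real) \<Rightarrow> real \<Rightarrow> (real \<Rightarrow> 'q) \<Rightarrow> real" where
  "action_functional Q L \<tau> \<gamma> = integral {0..\<tau>} (\<lambda>t. L (velocity Q {0..\<tau>} \<gamma> t))"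

definition reduced_functional ::
  "('b, 'f::euclidean_space) manifold \<Rightarrow> ('b tangent_vector \<times> real \<Rightarrow> real) \<Rightarrow> real
     \<Rightarrow> (real \<Rightarrow> 'b) \<Rightarrow> (real \<Rightarrow> real) \<Rightarrow> real" where
  "reduced_functional B l \<tau> x y =
     integral {0..\<tau>} (\<lambda>t. exp (integral {0..t} y) * l (velocity B {0..\<tau>} x t, y t))"

text \<open>A variation of a curve \<open>(x, y)\<close> in \<open>B \<times> \<real>\<close> consists of its two components: the vector
  \<open>\<delta>x\<close> obtained by pushing forward along \<open>fst\<close>, and the number \<open>\<delta>y\<close> obtained by applying the
  differential of the coordinate \<open>snd\<close>.\<close>

definition variation_fst ::
  "('b, 'f::euclidean_space) manifold \<Rightarrow> (real \<Rightarrow> ('b \<times> real) tangent_vector) \<Rightarrow> real \<Rightarrow> 'b tangent_vector"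
  where
  "variation_fst B \<delta>c t = pushforward (product_manifold B euclidean_manifold) B fst (\<delta>c t)"

definition variation_snd :: "(real \<Rightarrow> ('b \<times> real) tangent_vector) \<Rightarrow> real \<Rightarrow> real" where
  "variation_snd \<delta>c t = differential snd (\<delta>c t)"

end

theory Submission
  imports Defs
begin

text \<open>
  The functional \<open>A\<close> is never differentiated under the integral sign. If \<open>\<gamma>, x, y, \<sigma>\<close> are interrelated,
  then \<open>f (\<gamma> t) = \<sigma> exp (\<integral>\<^sub>0\<^sup>t y)\<close>, and with \<open>L v = f q \<cdot> l (\<pi>\<^sub>* v, d (ln f) v)\<close> this gives
  \<open>A \<gamma> = \<sigma> \<cdot> A' (x, y)\<close>, \<open>A'\<close> being the reduced functional.
  A family \<open>\<Gamma>\<close> that represents an admissible variation of \<open>\<gamma>\<close> projects to a family \<open>(X, Y)\<close>, and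
  \<open>A (\<Gamma>\<^sub>s) = f (\<Gamma> s 0) \<cdot> A' (X\<^sub>s, Y\<^sub>s)\<close>, where \<open>f (\<Gamma> s 0)\<close> has derivative 0 at \<open>s = 0\<close>.
  Conversely a family \<open>(X, Y)\<close> lifts to \<open>\<Gamma> s t = (\<pi>, f)\<^sup>-\<^sup>1 (X s t, \<sigma> exp (\<integral>\<^sub>0\<^sup>t Y s))\<close>, for which
  \<open>A (\<Gamma>\<^sub>s) = \<sigma> \<cdot> A' (X\<^sub>s, Y\<^sub>s)\<close>. The condition \<open>\<integral>\<^sub>0\<^sup>\<tau> \<delta>y = 0\<close> corresponds to the vanishing of the
  \<open>f\<close>-component of \<open>\<delta>\<gamma> \<tau>\<close>, since \<open>ln (f (\<Gamma> s \<tau>)) - ln (f (\<Gamma> s 0)) = \<integral>\<^sub>0\<^sup>\<tau> Y s\<close>.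
\<close>

section \<open>Calculus of functions of class \<open>C\<^sup>k\<close>\<close>

text \<open>\<open>has_first_variation\<close> ranges over every family that represents a variation,
  and asserts that the derivative exists as well as that it is 0. So it suffices to turn each family
  on one side into a family on the other with the functionals related slice by slice; existence and
  value of the derivative then transfer together. The new variation is defined as the velocity at
  \<open>s = 0\<close> of the new family, and what remains is that it is smooth and admissible. The
  obstacle is regularity up to the end points of \<open>{0..\<tau>}\<close>. Smoothness on a closed
  interval means local extendability, while the lift contains an integral from 0 to \<open>t\<close>
  that has to be smooth in \<open>s\<close> and \<open>t\<close> jointly, and the integral of
  \<delta>y has to be recognized as an \<open>s\<close>-derivative. Both reduce to a smooth
  extension on an open strip. Smoothness is handled at single points in charts, and tangent vectors
  occur as velocities, so that identities between vectors become identities between derivatives of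
  real functions of one variable.\<close>

abbreviation infinitely_differentiable_on ::
  "'a::euclidean_space set \<Rightarrow> ('a \<Rightarrow> 'b::euclidean_space) \<Rightarrow> bool" where
  "infinitely_differentiable_on U g \<equiv> \<forall>k. times_continuously_differentiable_on k U g"

text \<open>A derivative depends only on the values near the point, so on an open set agreement of
  two functions passes to their derivatives in every direction. Openness matters because derivatives
  are taken at \<open>at x\<close>, not within \<open>U\<close>.\<close>

lemma tcd_cong:
  assumes "open U" "\<And>x. x \<in> U \<Longrightarrow> g x = h x" "times_continuously_differentiable_on k U g"
  shows "times_continuously_differentiable_on k U h"
  using assms(2,3)
proof (induction k arbitrary: g h)
  case 0
  then show ?case by (simp cong: continuous_on_cong)
next
  case (Suc k)
  have d: "(h has_derivative frechet_derivative g (at x)) (at x)" if "x \<in> U" for x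
    by (rule has_derivative_transform_within_open[of g _ x UNIV U])
      (use Suc.prems \<open>open U\<close> that frechet_derivative_works in auto)
  have "times_continuously_differentiable_on k U (\<lambda>x. frechet_derivative h (at x) v)" for v
    by (rule Suc.IH[of "\<lambda>x. frechet_derivative g (at x) v"])
      (use frechet_derivative_at[OF d] Suc.prems in auto)
  then show ?case
    using d by (auto simp: differentiable_def)
qed

text \<open>Trades the derivative selected by \<open>frechet_derivative\<close> for an explicit
  formula \<open>g'\<close>; the two agree because derivatives are unique. The inductions on
  \<open>k\<close> below produce their formulas through this rule.\<close>

lemma tcd_Suc_I:
  assumes "open U" "\<And>x. x \<in> U \<Longrightarrow> (g has_derivative g' x) (at x)"
    and "\<And>v. times_continuously_differentiable_on k U (\<lambda>x. g' x v)"
  shows "times_continuously_differentiable_on (Suc k) U g"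
proof -
  have "times_continuously_differentiable_on k U (\<lambda>x. frechet_derivative g (at x) v)" for v
    by (rule tcd_cong[OF assms(1) _ assms(3)[of v]]) (simp add: frechet_derivative_at[OF assms(2)])
  then show ?thesis
    using assms(2) by (auto simp: differentiable_def)
qed

lemma tcd_Suc_D:
  assumes "times_continuously_differentiable_on (Suc k) U g"
  shows "x \<in> U \<Longrightarrow> (g has_derivative frechet_derivative g (at x)) (at x)"
    and "times_continuously_differentiable_on k U (\<lambda>x. frechet_derivative g (at x) v)"
  using assms frechet_derivative_works by auto

lemma tcd_subset:
  "times_continuously_differentiable_on k U g \<Longrightarrow> V \<subseteq> U \<Longrightarrow> times_continuously_differentiable_on k V g"
proof (induction k arbitrary: g)
  case (Suc k)
  then show ?case by (auto simp: subset_iff)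
qed (auto intro: continuous_on_subset)

text \<open>For functions patched together from local pieces, as in
  \<open>smooth_extension_strip\<close>.\<close>

lemma tcd_local:
  assumes "\<And>x. x \<in> U \<Longrightarrow> \<exists>V. open V \<and> x \<in> V \<and> times_continuously_differentiable_on k V g"
  shows "times_continuously_differentiable_on k U g"
  using assms
proof (induction k arbitrary: g)
  case 0
  have "isCont g x" if x: "x \<in> U" for x
    using 0[OF x] continuous_on_eq_continuous_at by auto
  then show ?case
    by (simp add: continuous_at_imp_continuous_on)
next
  case (Suc k)
  have "g differentiable (at x)" if "x \<in> U" for x
    using Suc.prems[OF that] by auto
  moreover have "times_continuously_differentiable_on k U (\<lambda>x. frechet_derivative g (at x) v)" for v
    by (rule Suc.IH) (use Suc.prems in \<open>force simp only: times_continuously_differentiable_on.simps\<close>)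
  ultimately show ?case
    by simp
qed

text \<open>The product and chain rules keep undifferentiated factors in the derivative, so their
  inductions need the functions themselves, not only their derivatives, one order lower.\<close>

lemma tcd_Suc_imp_tcd:
  assumes "open U" "times_continuously_differentiable_on (Suc k) U g"
  shows "times_continuously_differentiable_on k U g"
  using assms(2)
proof (induction k arbitrary: g)
  case 0
  then have "isCont g x" if "x \<in> U" for x
    using that differentiable_imp_continuous_within by auto
  then show ?case
    by (simp add: continuous_at_imp_continuous_on)
next
  case (Suc k)
  have "times_continuously_differentiable_on k U (\<lambda>x. frechet_derivative g (at x) v)" for v
    using Suc.IH tcd_Suc_D(2)[OF Suc.prems] by blast
  then show ?case
    using tcd_Suc_D[OF Suc.prems] by (intro tcd_Suc_I[OF assms(1)])
qed

section \<open>Closure properties of C^k functions and the elementary functions\<close>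

lemma tcd_const: "open U \<Longrightarrow> times_continuously_differentiable_on k U (\<lambda>x. c)"
proof (induction k arbitrary: c)
  case (Suc k)
  then show ?case by (intro tcd_Suc_I[where g' = "\<lambda>x v. 0"]) auto
qed simp

lemma tcd_bounded_linear:
  assumes "bounded_linear l" "open U"
  shows "times_continuously_differentiable_on k U l"
proof (cases k)
  case 0
  then show ?thesis
    using assms by (simp add: linear_continuous_on)
next
  case (Suc k)
  show ?thesis
    unfolding Suc
    by (rule tcd_Suc_I[where g' = "\<lambda>x. l"])
      (use assms tcd_const bounded_linear.has_derivative[OF assms(1) has_derivative_ident] in auto)
qed

lemma tcd_linear_compose:
  assumes "bounded_linear l" "open U" "times_continuously_differentiable_on k U g"
  shows "times_continuously_differentiable_on k U (\<lambda>x. l (g x))"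
  using assms(3)
proof (induction k arbitrary: g)
  case 0
  then show ?case
    using bounded_linear.continuous_on[OF assms(1)] by simp
next
  case (Suc k)
  show ?case
    by (rule tcd_Suc_I[OF assms(2), where g' = "\<lambda>x v. l (frechet_derivative g (at x) v)"])
      (use Suc.IH tcd_Suc_D[OF Suc.prems] bounded_linear.has_derivative[OF assms(1)] in blast)+
qed

lemma tcd_add:
  assumes "open U" "times_continuously_differentiable_on k U g" "times_continuously_differentiable_on k U h"
  shows "times_continuously_differentiable_on k U (\<lambda>x. g x + h x)"
  using assms(2,3)
proof (induction k arbitrary: g h)
  case 0
  then show ?case by (simp add: continuous_on_add)
next
  case (Suc k)
  show ?case
    by (rule tcd_Suc_I[OF assms(1), where
          g' = "\<lambda>x v. frechet_derivative g (at x) v + frechet_derivative h (at x) v"])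
      (use Suc.IH tcd_Suc_D[OF Suc.prems(1)] tcd_Suc_D[OF Suc.prems(2)] has_derivative_add in blast)+
qed

lemma tcd_sum:
  assumes "open U" "\<And>i. i \<in> A \<Longrightarrow> times_continuously_differentiable_on k U (g i)"
  shows "times_continuously_differentiable_on k U (\<lambda>x. \<Sum>i\<in>A. g i x)"
  using assms(2)
  by (induction A rule: infinite_finite_induct) (simp_all add: tcd_const tcd_add assms(1))

lemma tcd_scaleR:
  fixes g :: "'a::euclidean_space \<Rightarrow> real"
  assumes "open U" "times_continuously_differentiable_on k U g" "times_continuously_differentiable_on k U h"
  shows "times_continuously_differentiable_on k U (\<lambda>x. g x *\<^sub>R h x)"
  using assms(2,3)
proof (induction k arbitrary: g h)
  case 0
  then show ?case by (simp add: continuous_on_scaleR)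
next
  case (Suc k)
  show ?case
  proof (rule tcd_Suc_I[OF assms(1)])
    show "((\<lambda>x. g x *\<^sub>R h x) has_derivative
        (\<lambda>v. g x *\<^sub>R frechet_derivative h (at x) v + frechet_derivative g (at x) v *\<^sub>R h x)) (at x)"
      if "x \<in> U" for x
      using that by (intro has_derivative_scaleR tcd_Suc_D(1)[OF Suc.prems(1)] tcd_Suc_D(1)[OF Suc.prems(2)])
    show "times_continuously_differentiable_on k U
        (\<lambda>x. g x *\<^sub>R frechet_derivative h (at x) v + frechet_derivative g (at x) v *\<^sub>R h x)" for v
      by (intro tcd_add[OF assms(1)] Suc.IH tcd_Suc_D(2)[OF Suc.prems(1)] tcd_Suc_D(2)[OF Suc.prems(2)]
          tcd_Suc_imp_tcd[OF assms(1) Suc.prems(1)] tcd_Suc_imp_tcd[OF assms(1) Suc.prems(2)])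
  qed
qed

text \<open>The definition of C^k speaks of derivatives in a fixed direction, but the chain rule
  evaluates the derivative of \<open>g\<close> in a direction that moves with \<open>x\<close>.
  Expanding that direction over \<open>Basis\<close> leaves scalar coefficients times derivatives of
  \<open>g\<close> in fixed directions, to which the induction hypothesis applies.\<close>

lemma tcd_compose:
  assumes "open U" "open V" "f ` U \<subseteq> V"
    and "times_continuously_differentiable_on k V g" "times_continuously_differentiable_on k U f"
  shows "times_continuously_differentiable_on k U (\<lambda>x. g (f x))"
  using assms(4,5)
proof (induction k arbitrary: g)
  case 0
  then show ?case
    using continuous_on_compose2[of V g U f] assms(3) by simp
next
  case (Suc k)
  have D: "((\<lambda>x. g (f x)) has_derivative
      (\<lambda>v. \<Sum>b\<in>Basis. (frechet_derivative f (at x) v \<bullet> b) *\<^sub>R frechet_derivative g (at (f x)) b)) (at x)"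
    if "x \<in> U" for x
  proof -
    have g: "(g has_derivative frechet_derivative g (at (f x))) (at (f x))"
      using tcd_Suc_D(1)[OF Suc.prems(1)] that assms(3) by blast
    then interpret bounded_linear "frechet_derivative g (at (f x))"
      by (rule has_derivative_bounded_linear)
    have "frechet_derivative g (at (f x)) w =
        (\<Sum>b\<in>Basis. (w \<bullet> b) *\<^sub>R frechet_derivative g (at (f x)) b)" for w
    proof -
      have "frechet_derivative g (at (f x)) (\<Sum>b\<in>Basis. (w \<bullet> b) *\<^sub>R b) =
          (\<Sum>b\<in>Basis. (w \<bullet> b) *\<^sub>R frechet_derivative g (at (f x)) b)"
        by (simp add: sum scaleR del: euclidean_representation)
      then show ?thesis by (simp only: euclidean_representation)
    qed
    then have "frechet_derivative g (at (f x)) \<circ> frechet_derivative f (at x) = (\<lambda>v. \<Sum>b\<in>Basis.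
        (frechet_derivative f (at x) v \<bullet> b) *\<^sub>R frechet_derivative g (at (f x)) b)"
      unfolding comp_def by blast
    then show ?thesis
      using diff_chain_at[OF tcd_Suc_D(1)[OF Suc.prems(2) that] g] by (simp only: comp_def)
  qed
  show ?case
  proof (rule tcd_Suc_I[OF assms(1) D])
    fix v
    have "times_continuously_differentiable_on k U (\<lambda>x. frechet_derivative f (at x) v \<bullet> b)" for b
      by (rule tcd_linear_compose[OF bounded_linear_inner_left assms(1) tcd_Suc_D(2)[OF Suc.prems(2)]])
    moreover have "times_continuously_differentiable_on k U (\<lambda>x. frechet_derivative g (at (f x)) b)" for b
      by (rule Suc.IH[OF tcd_Suc_D(2)[OF Suc.prems(1)] tcd_Suc_imp_tcd[OF assms(1) Suc.prems(2)]])
    ultimately show "times_continuously_differentiable_on k U (\<lambda>x. \<Sum>b\<in>Basis.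
        (frechet_derivative f (at x) v \<bullet> b) *\<^sub>R frechet_derivative g (at (f x)) b)"
      by (intro tcd_sum[OF assms(1)] tcd_scaleR[OF assms(1)])
  qed
qed

lemma tcd_Pair:
  assumes "open U" "times_continuously_differentiable_on k U g" "times_continuously_differentiable_on k U h"
  shows "times_continuously_differentiable_on k U (\<lambda>x. (g x, h x))"
proof -
  have "bounded_linear (\<lambda>x::'b. (x, 0::'c))" "bounded_linear (\<lambda>x::'c. (0::'b, x))"
    by (auto intro!: bounded_linear_Pair bounded_linear_zero bounded_linear_ident)
  from tcd_add[OF assms(1) tcd_linear_compose[OF this(1) assms(1,2)] tcd_linear_compose[OF this(2) assms(1,3)]]
  show ?thesis by simp
qed

text \<open>The derivative is expressed through the function itself, so the induction hypothesis
  covers it; \<open>tcd_inverse\<close> works in the same way.\<close>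

lemma tcd_exp: "open U \<Longrightarrow> times_continuously_differentiable_on k U (exp :: real \<Rightarrow> real)"
proof (induction k)
  case 0
  show ?case
    using continuous_on_exp[OF continuous_on_id] by simp
next
  case (Suc k)
  show ?case
  proof (rule tcd_Suc_I[OF Suc.prems])
    show "(exp has_derivative (\<lambda>v. v *\<^sub>R exp x)) (at x)" for x :: real
      by (rule has_derivative_eq_rhs[OF DERIV_exp[of x, unfolded has_field_derivative_def]])
        (simp add: fun_eq_iff)
    show "times_continuously_differentiable_on k U (\<lambda>x. v *\<^sub>R exp x)" for v :: real
      by (intro tcd_scaleR tcd_const Suc)
  qed
qed

lemma tcd_inverse:
  "open U \<Longrightarrow> 0 \<notin> U \<Longrightarrow> times_continuously_differentiable_on k U (inverse :: real \<Rightarrow> real)"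
proof (induction k)
  case 0
  then show ?case
    using continuous_on_inverse[OF continuous_on_id, of U] by auto
next
  case (Suc k)
  show ?case
  proof (rule tcd_Suc_I[OF Suc.prems(1)])
    show "(inverse has_derivative (\<lambda>v. (- v) *\<^sub>R (inverse x *\<^sub>R inverse x))) (at x)" if "x \<in> U" for x :: real
      using that Suc.prems(2)
      by (intro has_derivative_eq_rhs[OF DERIV_inverse[of x UNIV, unfolded has_field_derivative_def]])
        (auto simp: fun_eq_iff power2_eq_square)
    show "times_continuously_differentiable_on k U (\<lambda>x. (- v) *\<^sub>R (inverse x *\<^sub>R inverse x))" for v :: real
      by (intro tcd_scaleR tcd_const Suc)
  qed
qed

lemma tcd_ln:
  assumes "open U" "U \<subseteq> {0<..}"
  shows "times_continuously_differentiable_on k U (ln :: real \<Rightarrow> real)"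
proof (cases k)
  case 0
  have "\<forall>x\<in>U. x \<noteq> 0"
    using assms by auto
  then show ?thesis
    using 0 continuous_on_ln[OF continuous_on_id, of U] by simp
next
  case (Suc k)
  show ?thesis
    unfolding Suc
  proof (rule tcd_Suc_I[OF assms(1)])
    show "(ln has_derivative (\<lambda>v. v *\<^sub>R inverse x)) (at x)" if "x \<in> U" for x :: real
      using that assms(2) by (intro has_derivative_eq_rhs[OF DERIV_ln[of x, unfolded has_field_derivative_def]])
        (auto simp: fun_eq_iff)
    show "times_continuously_differentiable_on k U (\<lambda>x. v *\<^sub>R inverse x)" for v :: real
      using assms by (intro tcd_scaleR tcd_const tcd_inverse) auto
  qed
qed

section \<open>Smoothness at a point of a manifold\<close>

text \<open>Smoothness of \<open>F\<close> at \<open>p\<close> in the charts \<open>\<phi>\<close> and \<open>\<eta>\<close>. The clause \<open>F q \<in> V\<close> makes continuity part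
  of the definition.\<close>

definition locally_smooth ::
  "'p set \<Rightarrow> ('p \<Rightarrow> 'e::euclidean_space) \<Rightarrow> 'q set \<Rightarrow> ('q \<Rightarrow> 'f::euclidean_space) \<Rightarrow> ('p \<Rightarrow> 'q) \<Rightarrow> 'p \<Rightarrow> bool"
  where
  "locally_smooth A \<phi> V \<eta> F p \<longleftrightarrow>
     (\<exists>N G. open N \<and> \<phi> p \<in> N \<and> infinitely_differentiable_on N G \<and>
        (\<forall>q\<in>A. \<phi> q \<in> N \<longrightarrow> F q \<in> V \<and> \<eta> (F q) = G (\<phi> q)))"

text \<open>Points near \<open>p\<close> land in the chart domain \<open>V\<close>, hence in the set
  \<open>C\<close> where the local representative of \<open>G\<close> is valid; this is where
  continuity built into \<open>locally_smooth\<close> is used.\<close>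

lemma locally_smooth_compose:
  assumes "locally_smooth A \<phi> V \<eta> F p" "locally_smooth C \<eta> X \<zeta> G (F p)" "p \<in> A"
    and "\<And>q. q \<in> A \<Longrightarrow> F q \<in> V \<Longrightarrow> F q \<in> C"
  shows "locally_smooth A \<phi> X \<zeta> (\<lambda>q. G (F q)) p"
proof -
  obtain N g where N: "open N" "\<phi> p \<in> N" "infinitely_differentiable_on N g"
    "\<And>q. q \<in> A \<Longrightarrow> \<phi> q \<in> N \<Longrightarrow> F q \<in> V \<and> \<eta> (F q) = g (\<phi> q)"
    using assms(1) unfolding locally_smooth_def by blast
  obtain P h where P: "open P" "\<eta> (F p) \<in> P" "infinitely_differentiable_on P h"
    "\<And>q. q \<in> C \<Longrightarrow> \<eta> q \<in> P \<Longrightarrow> G q \<in> X \<and> \<zeta> (G q) = h (\<eta> q)"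
    using assms(2) unfolding locally_smooth_def by blast
  \<comment> \<open>The part of \<open>N\<close> that \<open>g\<close> maps into \<open>P\<close>;
    it is open because \<open>g\<close> is continuous, the case \<open>k = 0\<close> of
    smoothness.\<close>
  define O' where "O' = N \<inter> g -` P"
  have "continuous_on N g"
    using N(3)[rule_format, of 0] by simp
  then have O: "open O'"
    unfolding O'_def using N(1) P(1) by (metis continuous_on_open_vimage inf_commute)
  have "infinitely_differentiable_on O' (\<lambda>z. h (g z))"
    using tcd_compose[OF O P(1) _ P(3)[rule_format] tcd_subset[OF N(3)[rule_format]]]
    by (auto simp: O'_def)
  moreover have "\<phi> p \<in> O'"
    using N(2) N(4)[OF assms(3) N(2)] P(2) by (simp add: O'_def)
  moreover have "G (F q) \<in> X \<and> \<zeta> (G (F q)) = h (g (\<phi> q))" if "q \<in> A" "\<phi> q \<in> O'" for q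
    using N(4)[of q] P(4)[of "F q"] assms(4)[of q] that by (auto simp: O'_def)
  ultimately show ?thesis
    unfolding locally_smooth_def using O by blast
qed

lemma locally_smooth_mono:
  "locally_smooth A \<phi> V \<eta> F p \<Longrightarrow> A' \<subseteq> A \<Longrightarrow> locally_smooth A' \<phi> V \<eta> F p"
  unfolding locally_smooth_def by blast

lemma locally_smooth_Pair:
  assumes "locally_smooth A \<phi> V \<eta> F p" "locally_smooth A \<phi> W \<zeta> G p"
  shows "locally_smooth A \<phi> (V \<times> W) (map_prod \<eta> \<zeta>) (\<lambda>q. (F q, G q)) p"
proof -
  obtain N g where N: "open N" "\<phi> p \<in> N" "infinitely_differentiable_on N g"
    "\<And>q. q \<in> A \<Longrightarrow> \<phi> q \<in> N \<Longrightarrow> F q \<in> V \<and> \<eta> (F q) = g (\<phi> q)"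
    using assms(1) unfolding locally_smooth_def by blast
  obtain P h where P: "open P" "\<phi> p \<in> P" "infinitely_differentiable_on P h"
    "\<And>q. q \<in> A \<Longrightarrow> \<phi> q \<in> P \<Longrightarrow> G q \<in> W \<and> \<zeta> (G q) = h (\<phi> q)"
    using assms(2) unfolding locally_smooth_def by blast
  have "infinitely_differentiable_on (N \<inter> P) (\<lambda>z. (g z, h z))"
    using N(1,3) P(1,3) by (auto intro!: tcd_Pair intro: tcd_subset)
  then show ?thesis
    unfolding locally_smooth_def using N P by (intro exI[of _ "N \<inter> P"]) auto
qed

text \<open>Besides smoothness of the transition maps, this says that their domains are open.\<close>

definition compatible_atlas :: "('p, 'e::euclidean_space) manifold \<Rightarrow> bool" where
  "compatible_atlas M \<longleftrightarrow>
     (\<forall>(U, \<phi>)\<in>atlas M. inj_on \<phi> U) \<and>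
     (\<forall>(U, \<phi>)\<in>atlas M. \<forall>(V, \<eta>)\<in>atlas M. \<forall>p\<in>U \<inter> V. locally_smooth U \<phi> V \<eta> (\<lambda>q. q) p)"

lemma compatible_atlasD:
  assumes "compatible_atlas M" "(U, \<phi>) \<in> atlas M"
  shows "inj_on \<phi> U"
    and "(V, \<eta>) \<in> atlas M \<Longrightarrow> p \<in> U \<Longrightarrow> p \<in> V \<Longrightarrow> locally_smooth U \<phi> V \<eta> (\<lambda>q. q) p"
  using assms unfolding compatible_atlas_def by fast+

text \<open>Since the image of \<open>U \<inter> V\<close> is relatively open in the model space, it
  is cut out by an open set \<open>P\<close>. A point of \<open>U\<close> whose chart value lies in
  \<open>P\<close> shares that value with a point of \<open>U \<inter> V\<close>, and injectivity of
  the chart puts it into \<open>V\<close>.\<close>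

lemma smooth_manifold_imp_compatible_atlas:
  assumes "smooth_manifold M"
  shows "compatible_atlas M"
proof -
  have "locally_smooth U \<phi> V \<eta> (\<lambda>q. q) p"
    if "(U, \<phi>) \<in> atlas M" "(V, \<eta>) \<in> atlas M" and p: "p \<in> U" "p \<in> V" for U \<phi> V \<eta> p
  proof -
    have inj: "inj_on \<phi> U"
      and op: "openin (top_of_set (model M)) (\<phi> ` (U \<inter> V))" "openin (top_of_set (model M)) (\<phi> ` (U \<inter> U))"
      and sm: "smooth_on (\<phi> ` (U \<inter> V)) (\<eta> \<circ> inv_into U \<phi>)"
      using assms that unfolding smooth_manifold_def by fast+
    obtain P where P: "open P" "\<phi> ` (U \<inter> V) = model M \<inter> P"
      using op(1) by (auto simp: openin_open)
    have sub: "\<phi> ` U \<subseteq> model M"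
      using openin_subset[OF op(2)] by simp
    obtain N G where N: "open N" "\<phi> p \<in> N" "infinitely_differentiable_on N G"
      "\<And>z. z \<in> \<phi> ` (U \<inter> V) \<inter> N \<Longrightarrow> G z = (\<eta> \<circ> inv_into U \<phi>) z"
      using sm p unfolding smooth_on_def by (metis IntI imageI)
    have "q \<in> V \<and> \<eta> q = G (\<phi> q)" if "q \<in> U" "\<phi> q \<in> N \<inter> P" for q
    proof -
      have "\<phi> q \<in> \<phi> ` (U \<inter> V)"
        using P(2) sub that by auto
      then have "q \<in> V"
        using inj that by (auto dest: inj_onD)
      then show ?thesis
        using N(4)[of "\<phi> q"] that inj by (auto simp: inv_into_f_f)
    qed
    moreover have "\<phi> p \<in> P"
      using p P(2) by blast
    ultimately show ?thesis
      unfolding locally_smooth_def using N(1-3) P(1)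
      by (intro exI[of _ "N \<inter> P"] exI[of _ G]) (auto intro: tcd_subset)
  qed
  moreover have "\<forall>(U, \<phi>)\<in>atlas M. inj_on \<phi> U"
    using assms unfolding smooth_manifold_def by blast
  ultimately show ?thesis
    unfolding compatible_atlas_def by blast
qed

section \<open>Euclidean spaces and products of manifolds\<close>

lemma compatible_euclidean: "compatible_atlas (euclidean_manifold :: ('a::euclidean_space, 'a) manifold)"
proof -
  have "locally_smooth UNIV id UNIV id (\<lambda>q. q) p" for p :: 'a
    unfolding locally_smooth_def
    by (intro exI[of _ UNIV] exI[of _ "\<lambda>x. x"]) (simp add: tcd_bounded_linear[OF bounded_linear_ident])
  then show ?thesis
    unfolding compatible_atlas_def by (auto simp: euclidean_manifold_def)
qed

lemma atlas_euclidean [simp]: "atlas euclidean_manifold = {(UNIV, id)}"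
  by (simp add: euclidean_manifold_def)

lemma points_euclidean [simp]: "points euclidean_manifold = UNIV"
  by (simp add: points_def)

lemma atlas_product:
  "(X, \<xi>) \<in> atlas (product_manifold M N) \<longleftrightarrow>
     (\<exists>U \<phi> V \<eta>. X = U \<times> V \<and> \<xi> = map_prod \<phi> \<eta> \<and> (U, \<phi>) \<in> atlas M \<and> (V, \<eta>) \<in> atlas N)"
  by (auto simp: product_manifold_def)

lemma mem_points: "p \<in> points M \<longleftrightarrow> (\<exists>U \<phi>. (U, \<phi>) \<in> atlas M \<and> p \<in> U)"
  by (auto simp: points_def)

lemma points_product [simp]: "points (product_manifold M N) = points M \<times> points N"
proof -
  have "(a, b) \<in> points (product_manifold M N) \<longleftrightarrow> a \<in> points M \<and> b \<in> points N" for a b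
    unfolding mem_points atlas_product by (metis mem_Sigma_iff)
  then show ?thesis by auto
qed

text \<open>An equality of atlases, not merely a diffeomorphism, so a pair of vector-valued
  functions can be composed directly with ordinary functions on a product of Euclidean
  spaces.\<close>

lemma product_euclidean [simp]:
  "product_manifold euclidean_manifold euclidean_manifold = euclidean_manifold"
  by (simp add: euclidean_manifold_def product_manifold_def map_prod.id)

lemma locally_smooth_fst: "locally_smooth (A \<times> C) (map_prod \<phi> \<eta>) A \<phi> fst p"
  unfolding locally_smooth_def
  using tcd_bounded_linear[OF bounded_linear_fst open_UNIV]
  by (intro exI[of _ UNIV] exI[of _ fst]) auto

lemma locally_smooth_snd: "locally_smooth (A \<times> C) (map_prod \<phi> \<eta>) C \<eta> snd p"
  unfolding locally_smooth_def
  using tcd_bounded_linear[OF bounded_linear_snd open_UNIV]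
  by (intro exI[of _ UNIV] exI[of _ snd]) auto

lemma compatible_product:
  assumes "compatible_atlas M" "compatible_atlas N"
  shows "compatible_atlas (product_manifold M N)"
proof -
  have "locally_smooth (U \<times> V) (map_prod \<phi> \<eta>) (U' \<times> V') (map_prod \<phi>' \<eta>') (\<lambda>q. q) p"
    if "(U, \<phi>) \<in> atlas M" "(V, \<eta>) \<in> atlas N" "(U', \<phi>') \<in> atlas M" "(V', \<eta>') \<in> atlas N"
      and p: "p \<in> U \<times> V" "p \<in> U' \<times> V'" for U \<phi> V \<eta> U' \<phi>' V' \<eta>' p
  proof -
    have "locally_smooth (U \<times> V) (map_prod \<phi> \<eta>) U' \<phi>' (\<lambda>q. fst q) p"
      by (rule locally_smooth_compose[OF locally_smooth_fst compatible_atlasD(2)[OF assms(1) that(1,3)]])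
        (use p in auto)
    moreover have "locally_smooth (U \<times> V) (map_prod \<phi> \<eta>) V' \<eta>' (\<lambda>q. snd q) p"
      by (rule locally_smooth_compose[OF locally_smooth_snd compatible_atlasD(2)[OF assms(2) that(2,4)]])
        (use p in auto)
    ultimately show ?thesis
      using locally_smooth_Pair by fastforce
  qed
  moreover have "inj_on (map_prod \<phi> \<eta>) (U \<times> V)" if "(U, \<phi>) \<in> atlas M" "(V, \<eta>) \<in> atlas N" for U \<phi> V \<eta>
    using compatible_atlasD(1)[OF assms(1) that(1)] compatible_atlasD(1)[OF assms(2) that(2)]
    by (rule map_prod_inj_on)
  ultimately show ?thesis
    unfolding compatible_atlas_def by (fastforce simp: atlas_product)
qed

text \<open>Exchanges open sets of \<open>mtop\<close> for Euclidean neighbourhoods in a given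
  chart. The topology is generated by sets from all charts, so the proof inducts on the generation;
  a generator from another chart is pulled back by the transition map, which is continuous.\<close>

lemma openin_mtop_chart:
  assumes "compatible_atlas M" "(U, \<phi>) \<in> atlas M" "openin (mtop M) W" "p \<in> W" "p \<in> U"
  shows "\<exists>N. open N \<and> \<phi> p \<in> N \<and> (\<forall>q\<in>U. \<phi> q \<in> N \<longrightarrow> q \<in> W)"
proof -
  have "generate_topology_on {U \<inter> \<phi> -` W | U \<phi> W. (U, \<phi>) \<in> atlas M \<and> open W} W"
    using assms(3) unfolding mtop_def by (simp add: openin_topology_generated_by_iff)
  then show ?thesis
    using assms(4)
  proof (induction)
    case (Int A C)
    have pAC: "p \<in> A" "p \<in> C"
      using Int.prems by auto
    obtain N where "open N" "\<phi> p \<in> N" "\<forall>q\<in>U. \<phi> q \<in> N \<longrightarrow> q \<in> A"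
      using Int.IH(1)[OF pAC(1)] by blast
    moreover obtain N' where "open N'" "\<phi> p \<in> N'" "\<forall>q\<in>U. \<phi> q \<in> N' \<longrightarrow> q \<in> C"
      using Int.IH(2)[OF pAC(2)] by blast
    ultimately show ?case
      by (intro exI[of _ "N \<inter> N'"]) auto
  next
    case (UN K)
    from UN.prems obtain k where k: "k \<in> K" "p \<in> k" by blast
    from UN.IH[OF k] k(1) show ?case by (metis UnionI)
  next
    case (Basis X)
    from Basis.hyps obtain V \<eta> P where X: "X = V \<inter> \<eta> -` P" "(V, \<eta>) \<in> atlas M" "open P"
      by blast
    have pV: "p \<in> V" "\<eta> p \<in> P"
      using Basis.prems X(1) by auto
    obtain N G where N: "open N" "\<phi> p \<in> N" "infinitely_differentiable_on N G"
      "\<And>q. q \<in> U \<Longrightarrow> \<phi> q \<in> N \<Longrightarrow> q \<in> V \<and> \<eta> q = G (\<phi> q)"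
      using compatible_atlasD(2)[OF assms(1,2) X(2) assms(5) pV(1)]
      unfolding locally_smooth_def by blast
    have "continuous_on N G"
      using N(3)[rule_format, of 0] by simp
    then have "open (N \<inter> G -` P)"
      using N(1) X(3) by (metis continuous_on_open_vimage inf_commute)
    then show ?case
      using N pV X(1) assms(5) by (intro exI[of _ "N \<inter> G -` P"]) auto
  qed auto
qed

text \<open>A pointwise form of \<open>smooth_map_on\<close> in which a Euclidean neighbourhood of
  the chart value replaces both the open set of \<open>mtop\<close> and \<open>inv_into\<close>. It
  is relative to \<open>S\<close>, so that closed intervals and their end points are
  covered.\<close>

definition smooth_at ::
  "('p, 'e::euclidean_space) manifold \<Rightarrow> 'p set \<Rightarrow> ('q, 'f::euclidean_space) manifold \<Rightarrow> ('p \<Rightarrow> 'q) \<Rightarrow> 'p \<Rightarrow> bool"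
  where
  "smooth_at M S N F p \<longleftrightarrow> p \<in> S \<and>
     (\<exists>U \<phi> V \<eta>. (U, \<phi>) \<in> atlas M \<and> (V, \<eta>) \<in> atlas N \<and> p \<in> U \<and> F p \<in> V \<and>
        locally_smooth (S \<inter> U) \<phi> V \<eta> F p)"

lemma openin_mtop_chart_vimage:
  "(U, \<phi>) \<in> atlas M \<Longrightarrow> open P \<Longrightarrow> openin (mtop M) (U \<inter> \<phi> -` P)"
  unfolding mtop_def by (intro topology_generated_by_Basis) blast

lemma smooth_map_on_iff_smooth_at:
  assumes "compatible_atlas M"
  shows "smooth_map_on M S N F \<longleftrightarrow> S \<subseteq> points M \<and> (\<forall>p\<in>S. smooth_at M S N F p)"
proof (intro iffI conjI ballI)
  assume L: "smooth_map_on M S N F"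
  then show "S \<subseteq> points M"
    by (simp add: smooth_map_on_def)
  fix p assume p: "p \<in> S"
  then obtain U \<phi> V \<eta> W where A: "(U, \<phi>) \<in> atlas M" "(V, \<eta>) \<in> atlas N"
    and W: "openin (mtop M) W" "p \<in> W" "W \<subseteq> U" "F ` (W \<inter> S) \<subseteq> V"
      "smooth_on (\<phi> ` (W \<inter> S)) (\<eta> \<circ> F \<circ> inv_into U \<phi>)"
    using L unfolding smooth_map_on_def by fast
  note inj = compatible_atlasD(1)[OF assms A(1)]
  obtain N' where N': "open N'" "\<phi> p \<in> N'" "\<And>q. q \<in> U \<Longrightarrow> \<phi> q \<in> N' \<Longrightarrow> q \<in> W"
    using openin_mtop_chart[OF assms A(1) W(1,2)] W by blast
  obtain P G where P: "open P" "\<phi> p \<in> P" "infinitely_differentiable_on P G"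
    "\<And>z. z \<in> \<phi> ` (W \<inter> S) \<inter> P \<Longrightarrow> G z = (\<eta> \<circ> F \<circ> inv_into U \<phi>) z"
    using W(5) p W(2) unfolding smooth_on_def by (metis IntI imageI)
  have "locally_smooth (S \<inter> U) \<phi> V \<eta> F p"
    unfolding locally_smooth_def
  proof (intro exI[of _ "N' \<inter> P"] exI[of _ G] conjI ballI impI)
    fix q assume "q \<in> S \<inter> U" "\<phi> q \<in> N' \<inter> P"
    then show "F q \<in> V" "\<eta> (F q) = G (\<phi> q)"
      using N'(3)[of q] W(4) P(4)[of "\<phi> q"] inj by (auto simp: inv_into_f_f)
  qed (use N' P in \<open>auto intro: tcd_subset\<close>)
  then show "smooth_at M S N F p"
    unfolding smooth_at_def using A p W by blast
next
  assume R: "S \<subseteq> points M \<and> (\<forall>p\<in>S. smooth_at M S N F p)"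
  have "\<exists>(U, \<phi>)\<in>atlas M. \<exists>(V, \<eta>)\<in>atlas N. \<exists>W. openin (mtop M) W \<and> p \<in> W \<and> W \<subseteq> U \<and>
      F ` (W \<inter> S) \<subseteq> V \<and> smooth_on (\<phi> ` (W \<inter> S)) (\<eta> \<circ> F \<circ> inv_into U \<phi>)" if p: "p \<in> S" for p
  proof -
    obtain U \<phi> V \<eta> P G where A: "(U, \<phi>) \<in> atlas M" "(V, \<eta>) \<in> atlas N" "p \<in> U"
      and P: "open P" "\<phi> p \<in> P" "infinitely_differentiable_on P G"
        "\<And>q. q \<in> S \<inter> U \<Longrightarrow> \<phi> q \<in> P \<Longrightarrow> F q \<in> V \<and> \<eta> (F q) = G (\<phi> q)"
      using R p unfolding smooth_at_def locally_smooth_def by metis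
    define W where "W = U \<inter> \<phi> -` P"
    have "smooth_on (\<phi> ` (W \<inter> S)) (\<eta> \<circ> F \<circ> inv_into U \<phi>)"
      unfolding smooth_on_def
    proof (intro ballI exI[of _ P] exI[of _ G] conjI)
      fix z assume "z \<in> \<phi> ` (W \<inter> S) \<inter> P"
      then show "G z = (\<eta> \<circ> F \<circ> inv_into U \<phi>) z"
        using P(4) compatible_atlasD(1)[OF assms A(1)] by (auto simp: W_def inv_into_f_f)
    qed (use P in \<open>auto simp: W_def\<close>)
    moreover have "F ` (W \<inter> S) \<subseteq> V" "p \<in> W" "W \<subseteq> U"
      using P A by (auto simp: W_def)
    moreover have "openin (mtop M) W"
      unfolding W_def by (rule openin_mtop_chart_vimage[OF A(1) P(1)])
    ultimately have "\<exists>W. openin (mtop M) W \<and> p \<in> W \<and> W \<subseteq> U \<and>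
      F ` (W \<inter> S) \<subseteq> V \<and> smooth_on (\<phi> ` (W \<inter> S)) (\<eta> \<circ> F \<circ> inv_into U \<phi>)"
      by blast
    then show ?thesis
      by (intro bexI[OF _ A(1)] bexI[OF _ A(2)] case_prodI)
  qed
  then show "smooth_map_on M S N F"
    using R unfolding smooth_map_on_def by blast
qed

section \<open>Independence of the charts, composition and restriction\<close>

lemma smooth_at_points:
  "smooth_at M S N F p \<Longrightarrow> p \<in> points M \<and> F p \<in> points N"
  unfolding smooth_at_def points_def by blast

lemma smooth_at_chart:
  assumes "compatible_atlas M" "smooth_at M S N F p" "(U, \<phi>) \<in> atlas M" "p \<in> U"
  shows "\<exists>V \<eta>. (V, \<eta>) \<in> atlas N \<and> F p \<in> V \<and> locally_smooth (S \<inter> U) \<phi> V \<eta> F p"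
proof -
  obtain U' \<phi>' V \<eta> where A: "(U', \<phi>') \<in> atlas M" "(V, \<eta>) \<in> atlas N" "p \<in> U'" "F p \<in> V" "p \<in> S"
    "locally_smooth (S \<inter> U') \<phi>' V \<eta> F p"
    using assms(2) unfolding smooth_at_def by blast
  have "locally_smooth (S \<inter> U) \<phi> U' \<phi>' (\<lambda>q. q) p"
    using compatible_atlasD(2)[OF assms(1,3) A(1)] A(3) assms(4) by (blast intro: locally_smooth_mono)
  then have "locally_smooth (S \<inter> U) \<phi> V \<eta> (\<lambda>q. F q) p"
    using locally_smooth_compose[of "S \<inter> U" \<phi> U' \<phi>' "\<lambda>q. q" p "S \<inter> U'" V \<eta> F] A assms(4) by auto
  then show ?thesis
    using A by auto
qed

lemma smooth_at_charts:
  assumes "compatible_atlas M" "compatible_atlas N" "smooth_at M S N F p" "(U, \<phi>) \<in> atlas M" "p \<in> U"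
    and "(V, \<eta>) \<in> atlas N" "F p \<in> V"
  shows "locally_smooth (S \<inter> U) \<phi> V \<eta> F p"
proof -
  obtain V' \<eta>' where A: "(V', \<eta>') \<in> atlas N" "F p \<in> V'" "locally_smooth (S \<inter> U) \<phi> V' \<eta>' F p"
    using smooth_at_chart[OF assms(1,3,4,5)] by blast
  show ?thesis
    by (rule locally_smooth_compose[OF A(3) compatible_atlasD(2)[OF assms(2) A(1) assms(6) A(2) assms(7)]])
      (use assms(3,5) in \<open>auto simp: smooth_at_def\<close>)
qed

text \<open>The last assumption is guarded by \<open>F q \<in> points N\<close> so that it holds
  trivially when \<open>T = points N\<close>.\<close>

lemma smooth_at_compose:
  assumes "compatible_atlas N" "smooth_at M S N F p" "smooth_at N T P G (F p)"
    and "\<And>q. q \<in> S \<Longrightarrow> F q \<in> points N \<Longrightarrow> F q \<in> T"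
  shows "smooth_at M S P (\<lambda>q. G (F q)) p"
proof -
  obtain U \<phi> V \<eta> where A: "(U, \<phi>) \<in> atlas M" "(V, \<eta>) \<in> atlas N" "p \<in> U" "F p \<in> V" "p \<in> S"
    "locally_smooth (S \<inter> U) \<phi> V \<eta> F p"
    using assms(2) unfolding smooth_at_def by blast
  obtain X \<zeta> where X: "(X, \<zeta>) \<in> atlas P" "G (F p) \<in> X" "locally_smooth (T \<inter> V) \<eta> X \<zeta> G (F p)"
    using smooth_at_chart[OF assms(1,3) A(2,4)] by blast
  have "V \<subseteq> points N"
    using A(2) by (auto simp: points_def)
  then have "locally_smooth (S \<inter> U) \<phi> X \<zeta> (\<lambda>q. G (F q)) p"
    by (intro locally_smooth_compose[OF A(6) X(3)]) (use A assms(4) in auto)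
  then show ?thesis
    unfolding smooth_at_def using A X by blast
qed

lemma smooth_at_Pair:
  assumes "compatible_atlas M" "smooth_at M S N F p" "smooth_at M S P G p"
  shows "smooth_at M S (product_manifold N P) (\<lambda>q. (F q, G q)) p"
proof -
  obtain U \<phi> V \<eta> where A: "(U, \<phi>) \<in> atlas M" "(V, \<eta>) \<in> atlas N" "p \<in> U" "F p \<in> V" "p \<in> S"
    "locally_smooth (S \<inter> U) \<phi> V \<eta> F p"
    using assms(2) unfolding smooth_at_def by blast
  obtain X \<zeta> where X: "(X, \<zeta>) \<in> atlas P" "G p \<in> X" "locally_smooth (S \<inter> U) \<phi> X \<zeta> G p"
    using smooth_at_chart[OF assms(1,3) A(1,3)] by blast
  have "(V \<times> X, map_prod \<eta> \<zeta>) \<in> atlas (product_manifold N P)"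
    using A X by (auto simp: atlas_product)
  then show ?thesis
    unfolding smooth_at_def
    using A X locally_smooth_Pair[OF A(6) X(3)] by blast
qed

lemma smooth_at_subset:
  "smooth_at M S N F p \<Longrightarrow> T \<subseteq> S \<Longrightarrow> p \<in> T \<Longrightarrow> smooth_at M T N F p"
  unfolding smooth_at_def by (blast intro: locally_smooth_mono)

lemma smooth_at_cong:
  assumes "smooth_at M S N F p" "\<And>q. q \<in> S \<Longrightarrow> F q = G q"
  shows "smooth_at M S N G p"
proof -
  have "locally_smooth (S \<inter> U) \<phi> V \<eta> F p \<Longrightarrow> locally_smooth (S \<inter> U) \<phi> V \<eta> G p" for U \<phi> V \<eta>
    using assms(2) unfolding locally_smooth_def by (metis IntD1)
  then show ?thesis
    using assms unfolding smooth_at_def by metis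
qed

text \<open>Smoothness is local: near \<open>p\<close> the sets \<open>S\<close> and
  \<open>S \<inter> W\<close> coincide in the chart. This is how a function known to be smooth on an
  open subset is used relative to the whole manifold.\<close>

lemma smooth_at_open:
  assumes "compatible_atlas M" "smooth_at M (S \<inter> W) N F p" "openin (mtop M) W"
  shows "smooth_at M S N F p"
proof -
  obtain U \<phi> V \<eta> where A: "(U, \<phi>) \<in> atlas M" "(V, \<eta>) \<in> atlas N" "p \<in> U" "F p \<in> V" "p \<in> S \<inter> W"
    and "locally_smooth (S \<inter> W \<inter> U) \<phi> V \<eta> F p"
    using assms(2) unfolding smooth_at_def by blast
  then obtain P G where P: "open P" "\<phi> p \<in> P" "infinitely_differentiable_on P G"
      "\<And>q. q \<in> S \<inter> W \<inter> U \<Longrightarrow> \<phi> q \<in> P \<Longrightarrow> F q \<in> V \<and> \<eta> (F q) = G (\<phi> q)"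
    unfolding locally_smooth_def by blast
  obtain N' where N': "open N'" "\<phi> p \<in> N'" "\<And>q. q \<in> U \<Longrightarrow> \<phi> q \<in> N' \<Longrightarrow> q \<in> W"
    using openin_mtop_chart[OF assms(1) A(1) assms(3) IntD2[OF A(5)] A(3)] by blast
  have "locally_smooth (S \<inter> U) \<phi> V \<eta> F p"
    unfolding locally_smooth_def
    by (intro exI[of _ "N' \<inter> P"] exI[of _ G]) (use N' P in \<open>auto intro: tcd_subset\<close>)
  then show ?thesis
    unfolding smooth_at_def using A by blast
qed

lemma smooth_at_fst:
  assumes "p \<in> S" "S \<subseteq> points M \<times> points N"
  shows "smooth_at (product_manifold M N) S M fst p"
proof -
  have "fst p \<in> points M" "snd p \<in> points N"
    using assms by auto
  then obtain U \<phi> V \<eta> where A: "(U, \<phi>) \<in> atlas M" "(V, \<eta>) \<in> atlas N" "p \<in> U \<times> V"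
    unfolding mem_points by (metis mem_Times_iff)
  then have "(U \<times> V, map_prod \<phi> \<eta>) \<in> atlas (product_manifold M N)"
    by (auto simp: atlas_product)
  moreover have "locally_smooth (S \<inter> U \<times> V) (map_prod \<phi> \<eta>) U \<phi> fst p"
    by (rule locally_smooth_mono[OF locally_smooth_fst]) auto
  moreover have "fst p \<in> U"
    using A(3) by auto
  ultimately show ?thesis
    unfolding smooth_at_def using A assms(1) by blast
qed

lemma smooth_at_snd:
  assumes "p \<in> S" "S \<subseteq> points M \<times> points N"
  shows "smooth_at (product_manifold M N) S N snd p"
proof -
  have "fst p \<in> points M" "snd p \<in> points N"
    using assms by auto
  then obtain U \<phi> V \<eta> where A: "(U, \<phi>) \<in> atlas M" "(V, \<eta>) \<in> atlas N" "p \<in> U \<times> V"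
    unfolding mem_points by (metis mem_Times_iff)
  then have "(U \<times> V, map_prod \<phi> \<eta>) \<in> atlas (product_manifold M N)"
    by (auto simp: atlas_product)
  moreover have "locally_smooth (S \<inter> U \<times> V) (map_prod \<phi> \<eta>) V \<eta> snd p"
    by (rule locally_smooth_mono[OF locally_smooth_snd]) auto
  moreover have "snd p \<in> V"
    using A(3) by auto
  ultimately show ?thesis
    unfolding smooth_at_def using A assms(1) by blast
qed

lemma smooth_at_euclidean:
  "smooth_at euclidean_manifold S euclidean_manifold F p \<longleftrightarrow> p \<in> S \<and>
     (\<exists>N G. open N \<and> p \<in> N \<and> infinitely_differentiable_on N G \<and> (\<forall>q\<in>S \<inter> N. F q = G q))"
  unfolding smooth_at_def locally_smooth_def by auto

section \<open>Functions smooth near a point\<close>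

lemma smooth_near_iff:
  assumes "compatible_atlas M"
  shows "g \<in> smooth_near M p \<longleftrightarrow> smooth_at M (points M) euclidean_manifold g p"
proof
  assume "g \<in> smooth_near M p"
  then obtain W where W: "openin (mtop M) W" "p \<in> W" "W \<subseteq> points M" "smooth_at M W euclidean_manifold g p"
    unfolding smooth_near_def smooth_map_on_iff_smooth_at[OF assms] by blast
  have "points M \<inter> W = W"
    using W(3) by (rule Int_absorb1)
  then show "smooth_at M (points M) euclidean_manifold g p"
    using smooth_at_open[OF assms _ W(1), of "points M"] W(4) by metis
next
  assume "smooth_at M (points M) euclidean_manifold g p"
  then obtain U \<phi> where A: "(U, \<phi>) \<in> atlas M" "p \<in> U"
    and "locally_smooth (points M \<inter> U) \<phi> UNIV id g p"
    unfolding smooth_at_def by auto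
  then obtain P G where P: "open P" "\<phi> p \<in> P" "infinitely_differentiable_on P G"
      "\<And>q. q \<in> points M \<inter> U \<Longrightarrow> \<phi> q \<in> P \<Longrightarrow> g q = G (\<phi> q)"
    unfolding locally_smooth_def id_apply by blast
  \<comment> \<open>The same \<open>G\<close> represents \<open>g\<close> at every point of
    \<open>W\<close>, which upgrades smoothness at \<open>p\<close> to smoothness on a
    neighbourhood.\<close>
  define W where "W = U \<inter> \<phi> -` P"
  have UM: "U \<subseteq> points M"
    using A by (auto simp: points_def)
  have "locally_smooth (W \<inter> U) \<phi> UNIV id g q" if "q \<in> W" for q
    unfolding locally_smooth_def
    by (intro exI[of _ P] exI[of _ G]) (use that P UM in \<open>auto simp: W_def\<close>)
  then have "smooth_at M W euclidean_manifold g q" if "q \<in> W" for q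
    unfolding smooth_at_def atlas_euclidean using A that by (auto simp: W_def)
  moreover have "W \<subseteq> points M" "p \<in> W"
    using UM A P by (auto simp: W_def)
  moreover have "openin (mtop M) W"
    unfolding W_def by (rule openin_mtop_chart_vimage[OF A(1) P(1)])
  ultimately show "g \<in> smooth_near M p"
    unfolding smooth_near_def smooth_map_on_iff_smooth_at[OF assms] by blast
qed

lemma chart_component_smooth_near:
  assumes "compatible_atlas M" "(U, \<phi>) \<in> atlas M" "p \<in> U"
  shows "(\<lambda>q. \<phi> q \<bullet> b) \<in> smooth_near M p"
proof -
  have "locally_smooth (points M \<inter> U) \<phi> UNIV id (\<lambda>q. \<phi> q \<bullet> b) p"
    unfolding locally_smooth_def
    using tcd_bounded_linear[OF bounded_linear_inner_left open_UNIV, of _ b]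
    by (intro exI[of _ UNIV] exI[of _ "\<lambda>z. z \<bullet> b"]) simp
  then show ?thesis
    unfolding smooth_near_iff[OF assms(1)] smooth_at_def atlas_euclidean
    using assms by (auto simp: points_def)
qed

section \<open>Velocities\<close>

lemma smooth_at_euclideanI:
  assumes "open N" "p \<in> N" "infinitely_differentiable_on N G"
  shows "smooth_at euclidean_manifold UNIV euclidean_manifold G p"
  unfolding smooth_at_euclidean using assms by (intro conjI exI[of _ N] exI[of _ G]) auto

lemma smooth_at_compose_euclidean:
  fixes k :: "'a::euclidean_space \<Rightarrow> 'b::euclidean_space"
  assumes "smooth_at M S euclidean_manifold g p"
    and "open N" "g p \<in> N" "infinitely_differentiable_on N k"
  shows "smooth_at M S euclidean_manifold (\<lambda>q. k (g q)) p"
  by (rule smooth_at_compose[OF compatible_euclidean assms(1) smooth_at_euclideanI[OF assms(2-4)]]) simp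

lemma smooth_at_compose_euclidean2:
  fixes k :: "'a::euclidean_space \<Rightarrow> 'b::euclidean_space \<Rightarrow> 'c::euclidean_space"
  assumes "compatible_atlas M" "smooth_at M S euclidean_manifold g p" "smooth_at M S euclidean_manifold h p"
    and "open N" "(g p, h p) \<in> N" "infinitely_differentiable_on N (\<lambda>z. k (fst z) (snd z))"
  shows "smooth_at M S euclidean_manifold (\<lambda>q. k (g q) (h q)) p"
  using smooth_at_compose_euclidean[OF smooth_at_Pair[OF assms(1-3), unfolded product_euclidean] assms(4-6)]
  by simp

lemma smooth_at_mult:
  fixes g h :: "'p \<Rightarrow> real"
  assumes "compatible_atlas M" "smooth_at M S euclidean_manifold g p" "smooth_at M S euclidean_manifold h p"
  shows "smooth_at M S euclidean_manifold (\<lambda>q. g q * h q) p"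
proof -
  have "infinitely_differentiable_on UNIV (\<lambda>z::real \<times> real. fst z *\<^sub>R snd z)"
    by (intro allI tcd_scaleR tcd_bounded_linear bounded_linear_fst bounded_linear_snd open_UNIV)
  then show ?thesis
    by (intro smooth_at_compose_euclidean2[OF assms open_UNIV]) simp_all
qed

lemma smooth_at_const:
  assumes "p \<in> S" "S \<subseteq> points M"
  shows "smooth_at M S euclidean_manifold (\<lambda>q. c) p"
proof -
  obtain U \<phi> where "(U, \<phi>) \<in> atlas M" "p \<in> U"
    using assms mem_points by (metis subsetD)
  moreover have "locally_smooth (S \<inter> U) \<phi> UNIV id (\<lambda>q. c) p"
    unfolding locally_smooth_def
    by (intro exI[of _ UNIV] exI[of _ "\<lambda>z. c"]) (simp add: tcd_const)
  ultimately show ?thesis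
    unfolding smooth_at_def atlas_euclidean using assms(1) by blast
qed

lemma smooth_at_add:
  fixes g h :: "'p \<Rightarrow> real"
  assumes "compatible_atlas M" "smooth_at M S euclidean_manifold g p" "smooth_at M S euclidean_manifold h p"
  shows "smooth_at M S euclidean_manifold (\<lambda>q. g q + h q) p"
proof -
  have "infinitely_differentiable_on UNIV (\<lambda>z::real \<times> real. fst z + snd z)"
    by (intro allI tcd_add tcd_bounded_linear bounded_linear_fst bounded_linear_snd open_UNIV)
  then show ?thesis
    by (intro smooth_at_compose_euclidean2[OF assms open_UNIV]) simp_all
qed

lemma smooth_at_divide:
  fixes g h :: "'p \<Rightarrow> real"
  assumes "compatible_atlas M" "smooth_at M S euclidean_manifold g p" "smooth_at M S euclidean_manifold h p"
    and "h p \<noteq> 0"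
  shows "smooth_at M S euclidean_manifold (\<lambda>q. g q / h q) p"
proof -
  have "smooth_at M S euclidean_manifold (\<lambda>q. inverse (h q)) p"
    by (rule smooth_at_compose_euclidean[OF assms(3), of "- {0}"]) (use assms(4) in \<open>auto intro!: tcd_inverse\<close>)
  from smooth_at_mult[OF assms(1,2) this] show ?thesis
    by (simp add: divide_inverse)
qed

lemma smooth_at_ln:
  assumes "smooth_at M S euclidean_manifold g p" "g p > 0"
  shows "smooth_at M S euclidean_manifold (\<lambda>q. ln (g q :: real)) p"
  by (rule smooth_at_compose_euclidean[OF assms(1), of "{0<..}"]) (use assms(2) in \<open>auto intro!: tcd_ln\<close>)

lemma smooth_near_linear_combination:
  assumes "compatible_atlas M" "g \<in> smooth_near M p" "h \<in> smooth_near M p"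
  shows "(\<lambda>q. a * g q + b * h q) \<in> smooth_near M p"
proof -
  have "p \<in> points M"
    using smooth_at_points[OF assms(2)[unfolded smooth_near_iff[OF assms(1)]]] by simp
  then show ?thesis
    using assms(2,3) unfolding smooth_near_iff[OF assms(1)]
    by (intro smooth_at_add[OF assms(1)] smooth_at_mult[OF assms(1)] smooth_at_const order_refl)
qed

lemma smooth_near_mult:
  assumes "compatible_atlas M" "g \<in> smooth_near M p" "h \<in> smooth_near M p"
  shows "(\<lambda>q. g q * h q) \<in> smooth_near M p"
  using assms(2,3) unfolding smooth_near_iff[OF assms(1)] by (rule smooth_at_mult[OF assms(1)])

lemma smooth_near_ln:
  assumes "compatible_atlas M" "g \<in> smooth_near M p" "g p > 0"
  shows "(\<lambda>q. ln (g q)) \<in> smooth_near M p"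
  using assms(2,3) unfolding smooth_near_iff[OF assms(1)] by (rule smooth_at_ln)

lemma smooth_near_compose:
  assumes "compatible_atlas M" "compatible_atlas N" "smooth_at M (points M) N F p" "g \<in> smooth_near N (F p)"
  shows "g \<circ> F \<in> smooth_near M p"
  using assms(4) smooth_at_compose[OF assms(2,3), of "points N" euclidean_manifold g]
  unfolding smooth_near_iff[OF assms(1)] smooth_near_iff[OF assms(2)] by (simp add: comp_def)

section \<open>Velocities as derivations, and their behaviour under maps\<close>

lemma smooth_at_euclidean_differentiable:
  fixes h :: "'a::euclidean_space \<Rightarrow> 'b::euclidean_space"
  assumes "smooth_at euclidean_manifold I euclidean_manifold h t"
  shows "h differentiable (at t within I)"
proof -
  obtain N G where N: "t \<in> I" "open N" "t \<in> N" "infinitely_differentiable_on N G" "\<And>q. q \<in> I \<inter> N \<Longrightarrow> h q = G q"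
    using assms unfolding smooth_at_euclidean by metis
  have "(G has_derivative frechet_derivative G (at t)) (at t within I)"
    using tcd_Suc_D(1)[OF N(4)[rule_format, of "Suc 0"] N(3)] by (rule has_derivative_at_withinI)
  then have "(h has_derivative frechet_derivative G (at t)) (at t within I)"
    by (rule has_derivative_transform_eventually)
      (use N in \<open>auto simp: eventually_at_topological\<close>)
  then show ?thesis
    by (auto simp: differentiable_def)
qed

text \<open>\<open>vector_derivative\<close> is a chosen value that says nothing unless a derivative
  exists; smoothness of \<open>c\<close> and \<open>g\<close> supplies existence, also at an end
  point of \<open>I\<close>.\<close>

lemma velocity_differentiable:
  assumes "compatible_atlas M" "smooth_at euclidean_manifold I M c t" "g \<in> smooth_near M (c t)"
  shows "((g \<circ> c) has_vector_derivative snd (velocity M I c t) g) (at t within I)"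
proof -
  have "smooth_at euclidean_manifold I euclidean_manifold (\<lambda>s. g (c s)) t"
    by (rule smooth_at_compose[OF assms(1,2) assms(3)[unfolded smooth_near_iff[OF assms(1)]]])
  then have "(g \<circ> c) differentiable (at t within I)"
    using smooth_at_euclidean_differentiable by (simp add: comp_def)
  then show ?thesis
    using assms(3) by (simp add: velocity_def vector_derivative_works)
qed

text \<open>Linearity and the Leibniz rule are those of differentiation at \<open>t\<close>. The
  condition on the filter makes derivatives within \<open>I\<close> unique, so the value chosen by
  \<open>vector_derivative\<close> is the computed one.\<close>

lemma velocity_in_tangent_space:
  assumes "compatible_atlas M" "smooth_at euclidean_manifold I M c t" "at t within I \<noteq> bot"
  shows "velocity M I c t \<in> tangent_space M (c t)"
proof -
  let ?D = "snd (velocity M I c t)"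
  note d = velocity_differentiable[OF assms(1,2)]
  have eq: "?D g = z" if "g \<in> smooth_near M (c t)" "((g \<circ> c) has_vector_derivative z) (at t within I)" for g z
    using vector_derivative_unique_within[OF assms(3) d[OF that(1)] that(2)] .
  have "?D (\<lambda>p. a * g p + b * h p) = a * ?D g + b * ?D h"
    if "g \<in> smooth_near M (c t)" "h \<in> smooth_near M (c t)" for g h a b
    by (rule eq[OF smooth_near_linear_combination[OF assms(1) that]])
      (use d[OF that(1)] d[OF that(2)] in \<open>auto simp: comp_def intro!: derivative_intros\<close>)
  moreover have "?D (\<lambda>p. g p * h p) = g (c t) * ?D h + h (c t) * ?D g"
    if "g \<in> smooth_near M (c t)" "h \<in> smooth_near M (c t)" for g h
    by (rule eq[OF smooth_near_mult[OF assms(1) that]])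
      (use has_vector_derivative_mult[OF d[OF that(1)] d[OF that(2)]] in \<open>simp add: comp_def mult.commute\<close>)
  moreover have "?D g = 0" if "g \<notin> smooth_near M (c t)" for g
    using that by (simp add: velocity_def)
  moreover have "velocity M I c t = (c t, ?D)"
    by (simp add: velocity_def)
  ultimately show ?thesis
    unfolding tangent_space_def by (simp only: mem_Collect_eq) blast
qed

text \<open>Both sides differentiate the same real function \<open>g \<circ> F \<circ> c\<close>.
  The point to check is the default value 0: for \<open>g\<close> smooth near the image point,
  \<open>g \<circ> F\<close> is smooth near \<open>c t\<close>, so the right side does not fall into
  its default.\<close>

lemma velocity_compose:
  assumes "compatible_atlas M" "compatible_atlas N" "smooth_at M (points M) N F (c t)"
  shows "velocity N I (\<lambda>s. F (c s)) t = pushforward M N F (velocity M I c t)"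
  unfolding velocity_def pushforward_def
  using smooth_near_compose[OF assms] by (auto simp: comp_def fun_eq_iff)

lemma vector_derivative_cong_within:
  assumes "t \<in> I" "\<And>s. s \<in> I \<Longrightarrow> f s = g s"
  shows "vector_derivative f (at t within I) = vector_derivative g (at t within I)"
  unfolding vector_derivative_def
  using has_vector_derivative_transform[OF assms(1), of f g] has_vector_derivative_transform[OF assms(1), of g f]
    assms(2) by metis

lemma velocity_cong:
  assumes "t \<in> I" "\<And>s. s \<in> I \<Longrightarrow> c s = d s"
  shows "velocity M I c t = velocity M I d t"
proof -
  have "vector_derivative (g \<circ> c) (at t within I) = vector_derivative (g \<circ> d) (at t within I)"
    for g :: "'a \<Rightarrow> real"
    by (rule vector_derivative_cong_within[OF assms(1)]) (simp add: assms(2))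
  then show ?thesis
    unfolding velocity_def using assms by (simp add: fun_eq_iff)
qed

lemma pushforward_zero [simp]: "pushforward M N F (zero_vector p) = zero_vector (F p)"
  by (simp add: pushforward_def zero_vector_def fun_eq_iff)

text \<open>A vector on the product acts on all functions \<open>g\<close> of both variables, so it
  does not suffice to test it on functions of one factor. In a chart \<open>g\<close> becomes a
  smooth \<open>G\<close> along a curve whose derivative is 0 in both components, and the chain rule
  gives 0.\<close>

lemma velocity_Pair_zero:
  fixes r :: "real \<Rightarrow> real"
  assumes M: "compatible_atlas M" and c: "smooth_at euclidean_manifold I M c t"
    and z: "velocity M I c t = zero_vector (c t)"
    and r: "(r has_vector_derivative 0) (at t within I)" and bot: "at t within I \<noteq> bot"
  shows "velocity (product_manifold M euclidean_manifold) I (\<lambda>s. (c s, r s)) t = zero_vector (c t, r t)"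
proof -
  let ?P = "product_manifold M euclidean_manifold :: ('a \<times> real, 'b \<times> real) manifold"
  have P: "compatible_atlas ?P"
    by (rule compatible_product[OF M compatible_euclidean])
  have "vector_derivative (g \<circ> (\<lambda>s. (c s, r s))) (at t within I) = 0" if g: "g \<in> smooth_near ?P (c t, r t)" for g
  proof -
    obtain U \<phi> where U: "(U, \<phi>) \<in> atlas M" "c t \<in> U"
      using smooth_at_points[OF c] mem_points by metis
    then have U2: "(U \<times> UNIV, map_prod \<phi> id) \<in> atlas ?P" "(c t, r t) \<in> U \<times> UNIV"
      by (auto simp: atlas_product)
    have "locally_smooth (points ?P \<inter> U \<times> UNIV) (map_prod \<phi> id) UNIV id g (c t, r t)"
      using g smooth_at_charts[OF P compatible_euclidean _ U2, of _ g UNIV id]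
      unfolding smooth_near_iff[OF P] by simp
    then obtain N G where N: "open N" "(\<phi> (c t), r t) \<in> N" "infinitely_differentiable_on N G"
      "\<And>q. q \<in> points ?P \<inter> U \<times> UNIV \<Longrightarrow> map_prod \<phi> id q \<in> N \<Longrightarrow> g q = G (map_prod \<phi> id q)"
      unfolding locally_smooth_def map_prod_simp id_apply by blast
    have cb: "((\<lambda>s. \<phi> (c s) \<bullet> b) has_vector_derivative 0) (at t within I)" for b
      using velocity_differentiable[OF M c chart_component_smooth_near[OF M U], of b] z
      by (simp add: zero_vector_def comp_def)
    have cd: "((\<lambda>s. \<phi> (c s)) has_vector_derivative 0) (at t within I)"
      using cb unfolding has_vector_derivative_def
      by (subst has_derivative_componentwise_within) simp
    have pd: "((\<lambda>s. (\<phi> (c s), r s)) has_vector_derivative 0) (at t within I)"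
      using has_vector_derivative_Pair[OF cd r] by (simp add: zero_prod_def)
    have Gd: "((\<lambda>s. G (\<phi> (c s), r s)) has_vector_derivative 0) (at t within I)"
    proof -
      have G: "(G has_derivative frechet_derivative G (at (\<phi> (c t), r t))) (at (\<phi> (c t), r t))"
        by (rule tcd_Suc_D(1)[OF N(3)[rule_format, of "Suc 0"] N(2)])
      interpret bounded_linear "frechet_derivative G (at (\<phi> (c t), r t))"
        using G by (rule has_derivative_bounded_linear)
      show ?thesis
        using diff_chain_within[OF pd[unfolded has_vector_derivative_def]
            has_derivative_at_withinI[OF G]] zero
        by (simp add: has_vector_derivative_def comp_def)
    qed
    \<comment> \<open>\<open>G\<close> represents \<open>g\<close> only over the chart domain;
      smoothness of \<open>c\<close> keeps \<open>c s\<close> in \<open>U\<close> for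
      \<open>s\<close> near \<open>t\<close>.\<close>
    have "locally_smooth (I \<inter> UNIV) id U \<phi> c t"
      by (rule smooth_at_charts[OF compatible_euclidean M c _ _ U]) auto
    then obtain N' H where N': "open N'" "t \<in> N'" "infinitely_differentiable_on N' H"
      "\<And>s. s \<in> I \<Longrightarrow> s \<in> N' \<Longrightarrow> c s \<in> U \<and> \<phi> (c s) = H s"
      unfolding locally_smooth_def id_apply by blast
    have tI: "t \<in> I"
      using c by (simp add: smooth_at_def)
    have "continuous (at t within I) (\<lambda>s. (\<phi> (c s), r s))"
      using pd by (rule has_vector_derivative_continuous)
    then have "eventually (\<lambda>s. (\<phi> (c s), r s) \<in> N) (at t within I)"
      unfolding continuous_within by (rule topological_tendstoD[OF _ N(1,2)])
    moreover have "eventually (\<lambda>s. s \<in> N' \<and> s \<in> I) (at t within I)"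
      using N'(1,2) by (auto simp: eventually_at_topological)
    ultimately have ev: "eventually (\<lambda>s. G (\<phi> (c s), r s) = g (c s, r s)) (at t within I)"
    proof eventually_elim
      case (elim s)
      then have "c s \<in> U"
        using N'(4) by blast
      then have "c s \<in> points M"
        using U(1) mem_points by metis
      then show ?case
        using N(4)[of "(c s, r s)"] elim \<open>c s \<in> U\<close> by simp
    qed
    have "c t \<in> points M"
      using U mem_points by metis
    then have eq: "G (\<phi> (c t), r t) = g (c t, r t)"
      using N(4)[of "(c t, r t)"] N(2) U(2) by simp
    have "((\<lambda>s. g (c s, r s)) has_vector_derivative 0) (at t within I)"
      unfolding has_vector_derivative_def
      by (rule has_derivative_transform_eventually[OF Gd[unfolded has_vector_derivative_def] ev eq tI])
    then show ?thesis
      using vector_derivative_within[OF bot] by (simp add: comp_def)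
  qed
  then show ?thesis
    unfolding velocity_def zero_vector_def by (auto simp: fun_eq_iff)
qed

section \<open>Families of curves\<close>

lemma at_within_Icc_neq_bot:
  fixes t \<tau> :: real
  assumes "0 < \<tau>" "t \<in> {0..\<tau>}"
  shows "at t within {0..\<tau>} \<noteq> bot"
  unfolding trivial_limit_within using islimpt_Icc[OF assms(1)] assms(2) by simp

lemma at_within_open_neq_bot:
  fixes t :: real
  assumes "open I" "t \<in> I"
  shows "at t within I \<noteq> bot"
  unfolding at_within_open[OF assms(2,1)] by simp

text \<open>Lets the two-sided derivative of a local extension \<open>g\<close> serve as the
  derivative of \<open>h\<close> within \<open>I\<close>, which is one-sided at an end
  point.\<close>

lemma has_vector_derivative_transfer:
  assumes "(g has_vector_derivative D) (at t)" "open A" "t \<in> A" "t \<in> I"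
    and "\<And>u. u \<in> I \<Longrightarrow> u \<in> A \<Longrightarrow> g u = h u"
  shows "(h has_vector_derivative D) (at t within I)"
  unfolding has_vector_derivative_def
proof (rule has_derivative_transform_eventually)
  show "(g has_derivative (\<lambda>x. x *\<^sub>R D)) (at t within I)"
    using assms(1) unfolding has_vector_derivative_def by (rule has_derivative_at_withinI)
  show "\<forall>\<^sub>F u in at t within I. g u = h u"
    using assms(2-) by (auto simp: eventually_at_topological)
qed (use assms in auto)

lemma partial_derivatives:
  fixes G :: "real \<times> real \<Rightarrow> 'b::euclidean_space"
  assumes "infinitely_differentiable_on N G" "(s, t) \<in> N"
  shows "((\<lambda>r. G (r, t)) has_vector_derivative frechet_derivative G (at (s, t)) (1, 0)) (at s)"
    and "((\<lambda>u. G (s, u)) has_vector_derivative frechet_derivative G (at (s, t)) (0, 1)) (at t)"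
proof -
  have G: "(G has_derivative frechet_derivative G (at (s, t))) (at (s, t))"
    by (rule tcd_Suc_D(1)[OF assms(1)[rule_format, of "Suc 0"] assms(2)])
  then interpret bounded_linear "frechet_derivative G (at (s, t))"
    by (rule has_derivative_bounded_linear)
  have "((\<lambda>r. (r, t)) has_derivative (\<lambda>x. x *\<^sub>R (1, 0))) (at s)" "((\<lambda>u. (s, u)) has_derivative (\<lambda>x. x *\<^sub>R (0, 1))) (at t)"
    by (auto intro!: derivative_eq_intros)
  then show "((\<lambda>r. G (r, t)) has_vector_derivative frechet_derivative G (at (s, t)) (1, 0)) (at s)"
    and "((\<lambda>u. G (s, u)) has_vector_derivative frechet_derivative G (at (s, t)) (0, 1)) (at t)"
    using diff_chain_at[of "\<lambda>r. (r, t)" _ s G] diff_chain_at[of "\<lambda>u. (s, u)" _ t G] G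
    by (auto simp: has_vector_derivative_def comp_def scale scaleR[symmetric])
qed

lemma smooth_family_slices:
  assumes "smooth_map_on euclidean_manifold (I \<times> J) M (\<lambda>(s, t). \<Gamma> s t)"
    and "s \<in> I" "t \<in> J"
  shows "smooth_at euclidean_manifold I M (\<lambda>r. \<Gamma> r t) (s::real)"
    and "smooth_at euclidean_manifold J M (\<lambda>u. \<Gamma> s u) (t::real)"
proof -
  have S: "smooth_at euclidean_manifold (I \<times> J) M (\<lambda>(s, t). \<Gamma> s t) (s, t)"
    using assms unfolding smooth_map_on_iff_smooth_at[OF compatible_euclidean] by auto
  have "smooth_at euclidean_manifold UNIV euclidean_manifold (\<lambda>r::real. (r, t)) s"
    "smooth_at euclidean_manifold UNIV euclidean_manifold (\<lambda>u::real. (s, u)) t"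
    by (intro smooth_at_euclideanI[OF open_UNIV] UNIV_I allI tcd_Pair tcd_const tcd_bounded_linear
        bounded_linear_ident open_UNIV)+
  then have "smooth_at euclidean_manifold I euclidean_manifold (\<lambda>r::real. (r, t)) s"
    "smooth_at euclidean_manifold J euclidean_manifold (\<lambda>u::real. (s, u)) t"
    using assms by (auto intro: smooth_at_subset)
  from smooth_at_compose[where p = s and F = "\<lambda>r. (r, t)", OF compatible_euclidean this(1) S]
    smooth_at_compose[where p = t and F = "\<lambda>u. (s, u)", OF compatible_euclidean this(2) S] assms
  show "smooth_at euclidean_manifold I M (\<lambda>r. \<Gamma> r t) s" "smooth_at euclidean_manifold J M (\<lambda>u. \<Gamma> s u) t"
    by auto
qed

text \<open>Supplies the variation that belongs to a constructed family. In the induced chart of the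
  tangent bundle the velocity field is \<open>G'\<close>, consisting of a local representative
  \<open>G\<close> of the family and its \<open>s\<close>-derivative, both restricted to
  \<open>s = 0\<close>; hence it is smooth in \<open>t\<close>.\<close>

lemma variation_of_smooth_family:
  assumes M: "compatible_atlas M" and e: "\<epsilon> > 0"
    and \<Gamma>: "smooth_map_on euclidean_manifold ({-\<epsilon><..<\<epsilon>} \<times> {0..\<tau>}) M (\<lambda>(s, t). \<Gamma> s t)"
    and c: "\<And>t. t \<in> {0..\<tau>} \<Longrightarrow> \<Gamma> 0 t = c t"
  shows "variation M \<tau> c (\<lambda>t. velocity M {-\<epsilon><..<\<epsilon>} (\<lambda>s. \<Gamma> s t) 0)"
  unfolding variation_def smooth_curve_def smooth_map_on_iff_smooth_at[OF compatible_euclidean]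
proof (intro conjI ballI)
  let ?\<delta> = "\<lambda>t. velocity M {-\<epsilon><..<\<epsilon>} (\<lambda>s. \<Gamma> s t) 0"
  have 0: "(0::real) \<in> {-\<epsilon><..<\<epsilon>}" using e by auto
  show ts: "?\<delta> t \<in> tangent_space M (c t)" if "t \<in> {0..\<tau>}" for t
    using velocity_in_tangent_space[OF M smooth_family_slices(1)[OF \<Gamma> 0 that]] at_within_open_neq_bot[OF _ 0] c[OF that]
    by simp
  fix t assume t: "t \<in> {0..\<tau>}"
  have "smooth_at euclidean_manifold ({-\<epsilon><..<\<epsilon>} \<times> {0..\<tau>}) M (\<lambda>(s, t). \<Gamma> s t) (0, t)"
    using \<Gamma> t 0 unfolding smooth_map_on_iff_smooth_at[OF compatible_euclidean] by auto
  then obtain V \<eta> where V: "(V, \<eta>) \<in> atlas M" "\<Gamma> 0 t \<in> V"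
    and "locally_smooth ({-\<epsilon><..<\<epsilon>} \<times> {0..\<tau>}) id V \<eta> (\<lambda>(s, t). \<Gamma> s t) (0, t)"
    unfolding smooth_at_def by auto
  then obtain N G where N: "open N" "(0, t) \<in> N" "infinitely_differentiable_on N G"
    "\<And>q. q \<in> {-\<epsilon><..<\<epsilon>} \<times> {0..\<tau>} \<Longrightarrow> q \<in> N \<Longrightarrow>
       (case q of (s, t) \<Rightarrow> \<Gamma> s t) \<in> V \<and> \<eta> (case q of (s, t) \<Rightarrow> \<Gamma> s t) = G q"
    unfolding locally_smooth_def id_apply by blast
  have NG: "\<Gamma> s u \<in> V" "\<eta> (\<Gamma> s u) = G (s, u)"
    if "s \<in> {-\<epsilon><..<\<epsilon>}" "u \<in> {0..\<tau>}" "(s, u) \<in> N" for s u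
    using N(4)[of "(s, u)"] that by auto
  define N' where "N' = (\<lambda>u. (0::real, u)) -` N"
  have N': "open N'" "t \<in> N'"
    using N(1,2) unfolding N'_def by (auto intro!: continuous_open_vimage continuous_intros)
  define G' where "G' = (\<lambda>u::real. (G (0, u), frechet_derivative G (at (0, u)) (1, 0)))"
  have emb: "times_continuously_differentiable_on k N' (\<lambda>u. (0::real, u))" for k
    using N'(1) by (intro tcd_Pair tcd_const tcd_bounded_linear bounded_linear_ident)
  have "infinitely_differentiable_on N' G'"
  proof
    fix k
    have "times_continuously_differentiable_on k N' (\<lambda>u. G (0, u))"
      by (rule tcd_compose[OF N'(1) N(1) _ N(3)[rule_format] emb]) (auto simp: N'_def)
    moreover have "times_continuously_differentiable_on k N' (\<lambda>u. frechet_derivative G (at (0, u)) (1, 0))"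
      by (rule tcd_compose[OF N'(1) N(1) _ tcd_Suc_D(2)[OF N(3)[rule_format]] emb]) (auto simp: N'_def)
    ultimately show "times_continuously_differentiable_on k N' G'"
      unfolding G'_def by (rule tcd_Pair[OF N'(1)])
  qed
  moreover have "fst (?\<delta> u) \<in> V \<and> ?\<delta> u \<in> tangent_vectors M \<and>
      (\<eta> (fst (?\<delta> u)), \<Sum>b\<in>Basis. snd (?\<delta> u) (\<lambda>p. \<eta> p \<bullet> b) *\<^sub>R b) = G' u"
    if u: "u \<in> {0..\<tau>}" "u \<in> N'" for u
  proof -
    have uN: "(0, u) \<in> N" using u(2) by (simp add: N'_def)
    have "snd (?\<delta> u) (\<lambda>p. \<eta> p \<bullet> b) = frechet_derivative G (at (0, u)) (1, 0) \<bullet> b" for b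
    proof -
      have "((\<lambda>r. G (r, u) \<bullet> b) has_vector_derivative frechet_derivative G (at (0, u)) (1, 0) \<bullet> b) (at 0)"
        by (rule bounded_linear.has_vector_derivative[OF bounded_linear_inner_left partial_derivatives(1)[OF N(3) uN]])
      moreover have "open ((\<lambda>r. (r, u)) -` N)"
        using N(1) by (auto intro!: continuous_open_vimage continuous_intros)
      ultimately have "((\<lambda>r. \<eta> (\<Gamma> r u) \<bullet> b) has_vector_derivative frechet_derivative G (at (0, u)) (1, 0) \<bullet> b)
          (at 0 within {-\<epsilon><..<\<epsilon>})"
        by (rule has_vector_derivative_transfer[OF _ _ _ 0]) (use uN NG u(1) in auto)
      moreover have "(\<lambda>p. \<eta> p \<bullet> b) \<in> smooth_near M (\<Gamma> 0 u)"
        by (rule chart_component_smooth_near[OF M V(1) NG(1)[OF 0 u(1) uN]])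
      ultimately show ?thesis
        using vector_derivative_within[OF at_within_open_neq_bot[OF _ 0]] by (simp add: velocity_def comp_def)
    qed
    moreover have "fst (?\<delta> u) = \<Gamma> 0 u"
      by (simp add: velocity_def)
    moreover have "?\<delta> u \<in> tangent_vectors M"
      using ts[OF u(1)] c[OF u(1)] NG(1)[OF 0 u(1) uN] V(1) mem_points unfolding tangent_vectors_def by fastforce
    ultimately show ?thesis
      using NG[OF 0 u(1) uN] by (simp add: G'_def euclidean_representation)
  qed
  ultimately have "locally_smooth ({0..\<tau>} \<inter> UNIV) id {v \<in> tangent_vectors M. fst v \<in> V}
      (\<lambda>v. (\<eta> (fst v), \<Sum>b\<in>Basis. snd v (\<lambda>p. \<eta> p \<bullet> b) *\<^sub>R b)) ?\<delta> t"
    unfolding locally_smooth_def using N' by (intro exI[of _ N'] exI[of _ G']) auto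
  moreover have "({v \<in> tangent_vectors M. fst v \<in> V},
      \<lambda>v. (\<eta> (fst v), \<Sum>b\<in>Basis. snd v (\<lambda>p. \<eta> p \<bullet> b) *\<^sub>R b)) \<in> atlas (tangent_bundle M)"
    using V(1) unfolding tangent_bundle_def by auto
  moreover have "?\<delta> t \<in> {v \<in> tangent_vectors M. fst v \<in> V}"
    using ts[OF t] c[OF t] V mem_points unfolding tangent_vectors_def by (fastforce simp: velocity_def)
  ultimately show "smooth_at euclidean_manifold {0..\<tau>} (tangent_bundle M) ?\<delta> t"
    unfolding smooth_at_def atlas_euclidean using t by blast
qed simp

section \<open>Derivatives and integrals of functions with a parameter\<close>

lemma smooth_on_time_derivative:
  fixes H :: "real \<Rightarrow> real \<Rightarrow> real"
  assumes \<tau>: "\<tau> > 0" and I: "open I"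
    and H: "smooth_map_on euclidean_manifold (I \<times> {0..\<tau>}) euclidean_manifold (\<lambda>(s, t). H s t)"
  shows "smooth_map_on euclidean_manifold (I \<times> {0..\<tau>}) euclidean_manifold
     (\<lambda>(s, t). vector_derivative (H s) (at t within {0..\<tau>}))"
  unfolding smooth_map_on_iff_smooth_at[OF compatible_euclidean]
proof (intro conjI ballI)
  fix p assume p: "p \<in> I \<times> {0..\<tau>}"
  obtain N G where N: "open N" "p \<in> N" "infinitely_differentiable_on N G"
    "\<And>q. q \<in> (I \<times> {0..\<tau>}) \<inter> N \<Longrightarrow> (case q of (s, t) \<Rightarrow> H s t) = G q"
    using H p unfolding smooth_map_on_iff_smooth_at[OF compatible_euclidean] smooth_at_euclidean by metis
  show "smooth_at euclidean_manifold (I \<times> {0..\<tau>}) euclidean_manifold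
      (\<lambda>(s, t). vector_derivative (H s) (at t within {0..\<tau>})) p"
    unfolding smooth_at_euclidean
  proof (intro conjI exI[of _ N] exI[of _ "\<lambda>q. frechet_derivative G (at q) (0, 1)"] p N ballI)
    show "infinitely_differentiable_on N (\<lambda>q. frechet_derivative G (at q) (0, 1))"
      using tcd_Suc_D(2)[OF N(3)[rule_format]] by blast
    fix q assume q: "q \<in> (I \<times> {0..\<tau>}) \<inter> N"
    obtain s t where st: "q = (s, t)" "s \<in> I" "t \<in> {0..\<tau>}" "(s, t) \<in> N"
      using q by auto
    have "open ((\<lambda>u. (s, u)) -` N)"
      using N(1) by (auto intro!: continuous_open_vimage continuous_intros)
    \<comment> \<open>At \<open>t = 0\<close> and \<open>t = \<tau>\<close> the derivative of
      \<open>H s\<close> is one-sided, yet it equals the partial derivative of the extension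
      \<open>G\<close>.\<close>
    then have "(H s has_vector_derivative frechet_derivative G (at (s, t)) (0, 1)) (at t within {0..\<tau>})"
      by (rule has_vector_derivative_transfer[OF partial_derivatives(2)[OF N(3) st(4)]])
        (use st N(4) in fastforce)+
    then show "(case q of (s, t) \<Rightarrow> vector_derivative (H s) (at t within {0..\<tau>})) = frechet_derivative G (at q) (0, 1)"
      using vector_derivative_within[OF at_within_Icc_neq_bot[OF \<tau> st(3)]] st(1) by simp
  qed
qed simp

lemma open_contains_box:
  fixes a b :: real
  assumes "open N" "(a, b) \<in> N"
  shows "\<exists>\<delta>>0. {a-\<delta><..<a+\<delta>} \<times> {b-\<delta><..<b+\<delta>} \<subseteq> N"
proof -
  obtain A C where A: "open A" "open C" "a \<in> A" "b \<in> C" "A \<times> C \<subseteq> N"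
    using open_prod_elim[OF assms] by (metis mem_Sigma_iff)
  obtain d where d: "d > 0" "ball a d \<subseteq> A" using A open_contains_ball by blast
  obtain e where e: "e > 0" "ball b e \<subseteq> C" using A open_contains_ball by blast
  have "{a-min d e<..<a+min d e} \<subseteq> ball a d" "{b-min d e<..<b+min d e} \<subseteq> ball b e"
    by (auto simp: dist_real_def)
  then show ?thesis
    using d e A(5) by (intro exI[of _ "min d e"]) (auto 0 4)
qed

text \<open>Local smooth extensions at the two end points of \<open>{s\<^sub>0} \<times> {0..\<tau>}\<close> fit together with the
  function itself, so no partition of unity is needed.\<close>

lemma smooth_extension_strip:
  fixes H :: "real \<Rightarrow> real \<Rightarrow> real"
  assumes \<tau>: "\<tau> > 0" and I: "open I" "s0 \<in> I"
    and H: "smooth_map_on euclidean_manifold (I \<times> {0..\<tau>}) euclidean_manifold (\<lambda>(s, t). H s t)"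
  obtains \<delta> G where "\<delta> > 0" "{s0-\<delta><..<s0+\<delta>} \<subseteq> I"
    "infinitely_differentiable_on ({s0-\<delta><..<s0+\<delta>} \<times> {-\<delta><..<\<tau>+\<delta>}) G"
    "\<And>s t. s \<in> {s0-\<delta><..<s0+\<delta>} \<Longrightarrow> t \<in> {0..\<tau>} \<Longrightarrow> H s t = G (s, t)"
proof -
  have ext: "\<exists>N G. open N \<and> p \<in> N \<and> infinitely_differentiable_on N G \<and>
      (\<forall>s\<in>I. \<forall>t\<in>{0..\<tau>}. (s, t) \<in> N \<longrightarrow> H s t = G (s, t))" if p: "p \<in> I \<times> {0..\<tau>}" for p
  proof -
    obtain N G where "open N" "p \<in> N" "infinitely_differentiable_on N G"
      "\<And>q. q \<in> (I \<times> {0..\<tau>}) \<inter> N \<Longrightarrow> (case q of (s, t) \<Rightarrow> H s t) = G q"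
      using H p unfolding smooth_map_on_iff_smooth_at[OF compatible_euclidean] smooth_at_euclidean by metis
    then show ?thesis
      by (intro exI[of _ N] exI[of _ G]) fastforce
  qed
  obtain N0 G0 where N0: "open N0" "(s0, 0) \<in> N0" "infinitely_differentiable_on N0 G0"
    "\<And>s t. s \<in> I \<Longrightarrow> t \<in> {0..\<tau>} \<Longrightarrow> (s, t) \<in> N0 \<Longrightarrow> H s t = G0 (s, t)"
    using ext[of "(s0, 0)"] \<tau> I by auto
  obtain N1 G1 where N1: "open N1" "(s0, \<tau>) \<in> N1" "infinitely_differentiable_on N1 G1"
    "\<And>s t. s \<in> I \<Longrightarrow> t \<in> {0..\<tau>} \<Longrightarrow> (s, t) \<in> N1 \<Longrightarrow> H s t = G1 (s, t)"
    using ext[of "(s0, \<tau>)"] \<tau> I by auto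
  obtain d0 where d0: "d0 > 0" "{s0-d0<..<s0+d0} \<times> {0-d0<..<0+d0} \<subseteq> N0"
    using open_contains_box[OF N0(1,2)] by blast
  obtain d1 where d1: "d1 > 0" "{s0-d1<..<s0+d1} \<times> {\<tau>-d1<..<\<tau>+d1} \<subseteq> N1"
    using open_contains_box[OF N1(1,2)] by blast
  obtain d2 where d2: "d2 > 0" "ball s0 d2 \<subseteq> I"
    using I open_contains_ball by blast
  define \<delta> where "\<delta> = min d0 (min d1 d2)"
  have \<delta>: "\<delta> > 0" "\<delta> \<le> d0" "\<delta> \<le> d1" "\<delta> \<le> d2"
    using d0 d1 d2 by (auto simp: \<delta>_def)
  let ?A = "{s0-\<delta><..<s0+\<delta>}"
  have A: "?A \<subseteq> I"
    using d2(2) \<delta>(4) by (auto simp: subset_iff dist_real_def)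
  have b0: "?A \<times> {-\<delta><..<\<delta>} \<subseteq> N0"
    using d0(2) \<delta>(2) by (auto simp: subset_iff)
  have b1: "?A \<times> {\<tau>-\<delta><..<\<tau>+\<delta>} \<subseteq> N1"
    using d1(2) \<delta>(3) by (auto simp: subset_iff)
  define G where "G = (\<lambda>(s, t). if t < 0 then G0 (s, t) else if t > \<tau> then G1 (s, t) else H s t)"
  have glue: "times_continuously_differentiable_on k (?A \<times> T) G"
    if "open T" "?A \<times> T \<subseteq> N" "infinitely_differentiable_on N E" "\<And>s t. s \<in> ?A \<Longrightarrow> t \<in> T \<Longrightarrow> G (s, t) = E (s, t)"
    for k T N E
    by (rule tcd_cong[OF _ _ tcd_subset[OF that(3)[rule_format] that(2)]])
      (use that(1,4) in \<open>auto intro: open_Times\<close>)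
  have "times_continuously_differentiable_on k (?A \<times> {-\<delta><..<\<tau>+\<delta>}) G" for k
  proof (rule tcd_local)
    fix p assume "p \<in> ?A \<times> {-\<delta><..<\<tau>+\<delta>}"
    then obtain s t where p: "p = (s, t)" "s \<in> ?A" "- \<delta> < t" "t < \<tau> + \<delta>"
      by auto
    consider "t \<le> 0" | "t \<ge> \<tau>" | "0 < t" "t < \<tau>"
      by linarith
    then show "\<exists>V. open V \<and> p \<in> V \<and> times_continuously_differentiable_on k V G"
    proof cases
      case 1
      \<comment> \<open>The bound \<open>min \<delta> \<tau>\<close> keeps \<open>u\<close> below
        \<open>\<tau>\<close>, away from the branch \<open>G1\<close>, and inside the box where
        \<open>H\<close> agrees with \<open>G0\<close>. Case 2 mirrors this with
        \<open>max 0 (\<tau>-\<delta>)\<close>.\<close>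
      have "G (r, u) = G0 (r, u)" if "r \<in> ?A" "u \<in> {-\<delta><..<min \<delta> \<tau>}" for r u
        using that A b0 N0(4)[of r u] by (auto simp: G_def subset_iff)
      then have "times_continuously_differentiable_on k (?A \<times> {-\<delta><..<min \<delta> \<tau>}) G"
        using b0 by (intro glue[OF _ _ N0(3)]) auto
      then show ?thesis
        using 1 p \<tau> \<delta>(1) by (intro exI[of _ "?A \<times> {-\<delta><..<min \<delta> \<tau>}"]) (auto intro: open_Times)
    next
      case 2
      have "G (r, u) = G1 (r, u)" if "r \<in> ?A" "u \<in> {max 0 (\<tau>-\<delta>)<..<\<tau>+\<delta>}" for r u
        using that A b1 N1(4)[of r u] by (auto simp: G_def subset_iff)
      then have "times_continuously_differentiable_on k (?A \<times> {max 0 (\<tau>-\<delta>)<..<\<tau>+\<delta>}) G"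
        using b1 by (intro glue[OF _ _ N1(3)]) auto
      then show ?thesis
        using 2 p \<tau> \<delta>(1) by (intro exI[of _ "?A \<times> {max 0 (\<tau>-\<delta>)<..<\<tau>+\<delta>}"]) (auto intro: open_Times)
    next
      case 3
      have stI: "(s, t) \<in> I \<times> {0..\<tau>}"
        using 3 p A by auto
      obtain N E where N: "open N" "(s, t) \<in> N" "infinitely_differentiable_on N E"
        "\<And>s t. s \<in> I \<Longrightarrow> t \<in> {0..\<tau>} \<Longrightarrow> (s, t) \<in> N \<Longrightarrow> H s t = E (s, t)"
        using ext[of "(s, t)"] stI by blast
      define V where "V = N \<inter> (?A \<times> {0<..<\<tau>})"
      have "open V" "(s, t) \<in> V"
        using N(1,2) 3 p by (auto simp: V_def intro!: open_Int open_Times)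
      moreover have "times_continuously_differentiable_on k V G"
      proof (rule tcd_cong[OF \<open>open V\<close> _ tcd_subset[OF N(3)[rule_format]]])
        show "E q = G q" if "q \<in> V" for q
          using that N(4)[of "fst q" "snd q"] A by (auto simp: V_def G_def subset_iff)
      qed (auto simp: V_def)
      ultimately show ?thesis
        using p(1) by blast
    qed
  qed
  moreover have "H s t = G (s, t)" if "s \<in> ?A" "t \<in> {0..\<tau>}" for s t
    using that by (auto simp: G_def)
  ultimately show ?thesis
    using that[of \<delta> G] \<delta>(1) A by blast
qed

text \<open>The Leibniz rule is applied to the extension, whose \<open>s\<close>-derivative is
  jointly continuous. With \<open>H = Y\<close> the right side is the integral of \<delta>y, which
  is how the constraint on \<delta>y becomes a statement about an
  \<open>s\<close>-derivative.\<close>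

lemma smooth_derivative_of_integral:
  fixes H :: "real \<Rightarrow> real \<Rightarrow> real"
  assumes \<tau>: "\<tau> > 0" and I: "open I" "s0 \<in> I"
    and H: "smooth_map_on euclidean_manifold (I \<times> {0..\<tau>}) euclidean_manifold (\<lambda>(s, t). H s t)"
  shows "((\<lambda>s. integral {0..\<tau>} (H s)) has_real_derivative
     integral {0..\<tau>} (\<lambda>t. vector_derivative (\<lambda>s. H s t) (at s0 within I))) (at s0)"
proof -
  obtain \<delta> G where \<delta>: "\<delta> > 0" "{s0-\<delta><..<s0+\<delta>} \<subseteq> I"
    and G: "infinitely_differentiable_on ({s0-\<delta><..<s0+\<delta>} \<times> {-\<delta><..<\<tau>+\<delta>}) G"
    "\<And>s t. s \<in> {s0-\<delta><..<s0+\<delta>} \<Longrightarrow> t \<in> {0..\<tau>} \<Longrightarrow> H s t = G (s, t)"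
    using smooth_extension_strip[OF \<tau> I H] by metis
  let ?A = "{s0-\<delta><..<s0+\<delta>}" and ?g = "\<lambda>s t. frechet_derivative G (at (s, t)) (1, 0)"
  have sub: "?A \<times> {0..\<tau>} \<subseteq> ?A \<times> {-\<delta><..<\<tau>+\<delta>}"
    using \<delta>(1) by auto
  have cont: "continuous_on (?A \<times> {0..\<tau>}) G" "continuous_on (?A \<times> {0..\<tau>}) (\<lambda>(s, t). ?g s t)"
    using G(1)[rule_format, of 0] tcd_Suc_D(2)[OF G(1)[rule_format, of "Suc 0"], of "(1, 0)"]
    by (auto intro!: continuous_on_subset[OF _ sub] simp: case_prod_unfold)
  have s0: "s0 \<in> ?A" using \<delta>(1) by simp
  have d: "((\<lambda>r. G (r, t)) has_vector_derivative ?g s t) (at s)" if "s \<in> ?A" "t \<in> {0..\<tau>}" for s t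
    by (rule partial_derivatives(1)[OF G(1)]) (use that \<delta>(1) in auto)
  have "((\<lambda>s. integral (cbox 0 \<tau>) (\<lambda>t. G (s, t))) has_field_derivative integral (cbox 0 \<tau>) (?g s0)) (at s0 within ?A)"
  proof (rule leibniz_rule_field_derivative[where fx = ?g])
    show "((\<lambda>s. G (s, t)) has_field_derivative ?g s t) (at s within ?A)" if "s \<in> ?A" "t \<in> cbox 0 \<tau>" for s t
      using d[of s t] that has_field_derivative_at_within by (simp add: has_real_derivative_iff_has_vector_derivative has_vector_derivative_at_within)
    show "(\<lambda>t. G (s, t)) integrable_on cbox 0 \<tau>" if "s \<in> ?A" for s
      by (rule integrable_continuous, rule continuous_on_compose2[OF cont(1)])
        (use that in \<open>auto intro!: continuous_intros\<close>)
  qed (use cont(2) s0 in auto)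
  then have int: "((\<lambda>s. integral {0..\<tau>} (\<lambda>t. G (s, t))) has_field_derivative integral {0..\<tau>} (?g s0)) (at s0)"
    using at_within_open[OF s0] by simp
  have eq: "integral {0..\<tau>} (\<lambda>t. G (s, t)) = integral {0..\<tau>} (H s)" if "s \<in> ?A" for s
    by (rule integral_cong) (simp add: G(2)[OF that])
  have "integral {0..\<tau>} (?g s0) = integral {0..\<tau>} (\<lambda>t. vector_derivative (\<lambda>s. H s t) (at s0 within I))"
  proof (rule integral_cong)
    fix t assume t: "t \<in> {0..\<tau>}"
    have "((\<lambda>s. H s t) has_vector_derivative ?g s0 t) (at s0 within I)"
      by (rule has_vector_derivative_transfer[OF d[OF s0 t], of ?A]) (use G(2) t s0 I in auto)
    then show "?g s0 t = vector_derivative (\<lambda>s. H s t) (at s0 within I)"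
      by (rule vector_derivative_within[OF at_within_open_neq_bot[OF I], symmetric])
  qed
  with int show ?thesis
    using has_field_derivative_transform_within_open[OF int open_greaterThanLessThan s0 eq] by simp
qed

text \<open>Writing the integral over \<open>{0..t}\<close> as \<open>t\<close> times an integral over \<open>{0..1}\<close> allows to
  differentiate with respect to both parameters at once.\<close>

lemma tcd_scaled_integral:
  fixes G :: "real \<times> real \<Rightarrow> real" and a :: "real \<Rightarrow> real"
  assumes U: "open U" "convex U" "\<And>s t u. (s, t) \<in> U \<Longrightarrow> u \<in> {0..1} \<Longrightarrow> (s, u * t) \<in> U"
    and "continuous_on {0..1} a" "times_continuously_differentiable_on k U G"
  shows "times_continuously_differentiable_on k U (\<lambda>p. integral {0..1} (\<lambda>u. a u * G (fst p, u * snd p)))"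
  using assms(4,5)
proof (induction k arbitrary: a G)
  case 0
  have "continuous_on (U \<times> {0..1}) (\<lambda>(p, u). a u * G (fst p, u * snd p))"
    unfolding case_prod_unfold
    by (intro continuous_on_mult continuous_on_compose2[OF 0(1) continuous_on_snd]
        continuous_on_compose2[OF 0(2)[simplified]] continuous_intros)
      (use U(3) in auto)
  then show ?case
    using integral_continuous_on_param[of U 0 "1::real" "\<lambda>p u. a u * G (fst p, u * snd p)"] by simp
next
  case (Suc k)
  \<comment> \<open>Differentiating in the second variable brings out a factor \<open>u\<close>. It
    is absorbed into the weight, so the induction has to range over all continuous
    \<open>a\<close>.\<close>
  let ?D1 = "\<lambda>p u. a u * frechet_derivative G (at (fst p, u * snd p)) (1, 0)"
  let ?D2 = "\<lambda>p u. (a u * u) * frechet_derivative G (at (fst p, u * snd p)) (0, 1)"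
  let ?I1 = "\<lambda>p. integral {0..1} (?D1 p)" and ?I2 = "\<lambda>p. integral {0..1} (?D2 p)"
  note D = tcd_Suc_D[OF Suc.prems(2)] and G = tcd_Suc_imp_tcd[OF U(1) Suc.prems(2)]
  have k0: "times_continuously_differentiable_on m U F \<Longrightarrow> continuous_on U F" for m and F :: "real \<times> real \<Rightarrow> real"
    by (induction m) (use tcd_Suc_imp_tcd[OF U(1)] in \<open>simp, blast\<close>)
  have cont: "continuous_on (U \<times> {0..1}) (\<lambda>(p, u). F (fst p, u * snd p))"
    if "continuous_on U F" for F :: "real \<times> real \<Rightarrow> real"
    unfolding case_prod_unfold
    by (intro continuous_on_compose2[OF that] continuous_intros) (use U(3) in auto)
  have conta: "continuous_on (U \<times> {0..1}) (\<lambda>x. a (snd x))"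
    by (intro continuous_on_compose2[OF Suc.prems(1) continuous_on_snd] continuous_intros) auto
  have cD: "continuous_on (U \<times> {0..1}) (\<lambda>(p, u). ?D1 p u)" "continuous_on (U \<times> {0..1}) (\<lambda>(p, u). ?D2 p u)"
    using cont[OF k0[OF D(2), of "(1, 0)"]] cont[OF k0[OF D(2), of "(0, 1)"]] conta
    by (auto simp: case_prod_unfold intro!: continuous_intros)
  have cs: "continuous_on {0..1} (F p)" if "continuous_on (U \<times> {0..1}) (\<lambda>(p, u). F p u)" "p \<in> U" for F :: "real \<times> real \<Rightarrow> real \<Rightarrow> real" and p
  proof -
    have "continuous_on {0..1} (\<lambda>u::real. (p, u))"
      by (intro continuous_intros)
    from continuous_on_compose2[OF that(1) this] that(2) show ?thesis
      by (simp add: image_subset_iff)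
  qed
  have der: "((\<lambda>p. integral {0..1} (\<lambda>u. a u * G (fst p, u * snd p))) has_derivative
      (\<lambda>v. ?I1 p * fst v + ?I2 p * snd v)) (at p)" if p: "p \<in> U" for p
  proof -
    \<comment> \<open>\<open>leibniz_rule\<close> takes the derivative as a bounded linear map
      depending continuously on the parameters. Writing it in the coordinates
      \<open>fst_blinfun\<close> and \<open>snd_blinfun\<close> makes its integral split into
      \<open>?I1\<close> and \<open>?I2\<close>.\<close>
    let ?L = "\<lambda>p u. ?D1 p u *\<^sub>R (fst_blinfun :: (real \<times> real) \<Rightarrow>\<^sub>L real) + ?D2 p u *\<^sub>R snd_blinfun"
    have "((\<lambda>p. integral (cbox 0 1) (\<lambda>u. a u * G (fst p, u * snd p))) has_derivative
        blinfun_apply (integral (cbox 0 1) (?L p))) (at p within U)"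
    proof (rule leibniz_rule[where fx = ?L])
      fix q and u :: real assume q: "q \<in> U" "u \<in> cbox 0 1"
      let ?q = "(fst q, u * snd q)"
      have "?q \<in> U" using U(3)[of "fst q" "snd q" u] q by simp
      then have Gq: "(G has_derivative frechet_derivative G (at ?q)) (at ?q)" by (rule D(1))
      interpret bounded_linear "frechet_derivative G (at ?q)"
        using Gq by (rule has_derivative_bounded_linear)
      have "((\<lambda>q. (fst q, u * snd q)) has_derivative (\<lambda>v. (fst v, u * snd v))) (at q)"
        by (auto intro!: derivative_eq_intros)
      from diff_chain_at[OF this Gq]
      have "((\<lambda>q. a u * G (fst q, u * snd q)) has_derivative
          (\<lambda>v. a u * frechet_derivative G (at ?q) (fst v, u * snd v))) (at q)"
        unfolding comp_def by (rule has_derivative_mult_right)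
      moreover have "a u * frechet_derivative G (at ?q) (fst v, u * snd v) = blinfun_apply (?L q u) v" for v
      proof -
        have "(fst v, u * snd v) = fst v *\<^sub>R (1, 0) + (u * snd v) *\<^sub>R (0, 1)"
          by simp
        then have "frechet_derivative G (at ?q) (fst v, u * snd v) =
            fst v * frechet_derivative G (at ?q) (1, 0) + (u * snd v) * frechet_derivative G (at ?q) (0, 1)"
          by (simp only: add scale real_scaleR_def)
        then show ?thesis
          by (simp add: blinfun.add_left blinfun.scaleR_left algebra_simps)
      qed
      ultimately show "((\<lambda>q. a u * G (fst q, u * snd q)) has_derivative blinfun_apply (?L q u)) (at q within U)"
        by (simp add: has_derivative_at_withinI)
    next
      fix q assume "q \<in> U"
      then have "continuous_on {0..1} (\<lambda>u. G (fst q, u * snd q))"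
        by (intro cs cont k0[OF G])
      then show "(\<lambda>u. a u * G (fst q, u * snd q)) integrable_on cbox 0 1"
        using Suc.prems(1) by (auto intro!: integrable_continuous_interval continuous_intros)
    next
      show "continuous_on (U \<times> cbox 0 1) (\<lambda>(p, u). ?L p u)"
        using cD by (auto simp: case_prod_unfold intro!: continuous_intros)
    qed (use p U in auto)
    moreover have "integral (cbox 0 1) (?L p) = ?I1 p *\<^sub>R fst_blinfun + ?I2 p *\<^sub>R snd_blinfun"
    proof -
      have "(?D1 p has_integral ?I1 p) {0..1}" "(?D2 p has_integral ?I2 p) {0..1}"
        using cs[OF cD(1) p] cs[OF cD(2) p] by (auto intro!: integrable_integral integrable_continuous_interval)
      then have "(?L p has_integral (?I1 p *\<^sub>R fst_blinfun + ?I2 p *\<^sub>R snd_blinfun)) {0..1}"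
        by (intro has_integral_add has_integral_scaleR_left)
      then show ?thesis
        unfolding box_real by (rule integral_unique)
    qed
    moreover have "blinfun_apply (x *\<^sub>R fst_blinfun + y *\<^sub>R snd_blinfun) = (\<lambda>v. x * fst v + y * snd v)"
      for x y :: real
      by (simp add: fun_eq_iff blinfun.add_left blinfun.scaleR_left)
    ultimately show ?thesis
      unfolding at_within_open[OF p U(1)] by (simp only: box_real)
  qed
  show ?case
  proof (rule tcd_Suc_I[OF U(1) der])
    fix v :: "real \<times> real"
    have "times_continuously_differentiable_on k U ?I1" "times_continuously_differentiable_on k U ?I2"
      by (rule Suc.IH[OF _ D(2)], use Suc.prems(1) in \<open>auto intro!: continuous_intros\<close>)+
    then have "times_continuously_differentiable_on k U (\<lambda>p. fst v *\<^sub>R ?I1 p + snd v *\<^sub>R ?I2 p)"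
      by (intro tcd_add tcd_scaleR tcd_const U(1))
    then show "times_continuously_differentiable_on k U (\<lambda>p. ?I1 p * fst v + ?I2 p * snd v)"
      by (simp add: mult.commute)
  qed
qed

text \<open>After rescaling, \<open>t\<close> times the integral of \<open>G (s, u * t)\<close> over
  \<open>u\<close> in \<open>{0..1}\<close> also makes sense for \<open>t\<close> slightly outside
  \<open>{0..\<tau>}\<close>, so it is a smooth extension of the integral across the end
  points.\<close>

lemma smooth_on_integral:
  fixes H :: "real \<Rightarrow> real \<Rightarrow> real"
  assumes \<tau>: "\<tau> > 0" and I: "open I"
    and H: "smooth_map_on euclidean_manifold (I \<times> {0..\<tau>}) euclidean_manifold (\<lambda>(s, t). H s t)"
  shows "smooth_map_on euclidean_manifold (I \<times> {0..\<tau>}) euclidean_manifold (\<lambda>(s, t). integral {0..t} (H s))"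
  unfolding smooth_map_on_iff_smooth_at[OF compatible_euclidean]
proof (intro conjI ballI)
  fix p assume p: "p \<in> I \<times> {0..\<tau>}"
  then obtain s0 t0 where st: "p = (s0, t0)" "s0 \<in> I" "t0 \<in> {0..\<tau>}"
    by auto
  obtain \<delta> G where \<delta>: "\<delta> > 0" "{s0-\<delta><..<s0+\<delta>} \<subseteq> I"
    and G: "infinitely_differentiable_on ({s0-\<delta><..<s0+\<delta>} \<times> {-\<delta><..<\<tau>+\<delta>}) G"
    "\<And>s t. s \<in> {s0-\<delta><..<s0+\<delta>} \<Longrightarrow> t \<in> {0..\<tau>} \<Longrightarrow> H s t = G (s, t)"
    using smooth_extension_strip[OF \<tau> I st(2) H] by metis
  let ?A = "{s0-\<delta><..<s0+\<delta>}"
  let ?U = "?A \<times> {-\<delta><..<\<tau>+\<delta>}"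
  let ?K = "\<lambda>p. snd p *\<^sub>R integral {0..1} (\<lambda>u. 1 * G (fst p, u * snd p))"
  have U: "open ?U" "convex ?U"
    by (auto intro!: open_Times convex_Times)
  \<comment> \<open>The strip contains the segment from \<open>(s, t)\<close> to
    \<open>(s, 0)\<close>, because 0 lies between \<open>- \<delta>\<close> and
    \<open>\<tau> + \<delta>\<close>.\<close>
  have star: "(s, u * t) \<in> ?U" if "(s, t) \<in> ?U" "u \<in> {0..1}" for s t u
  proof -
    have "\<bar>u * t\<bar> \<le> \<bar>t\<bar>" using that(2) by (auto simp: abs_mult mult_left_le_one_le)
    moreover have "t \<ge> 0 \<Longrightarrow> u * t \<ge> 0" "t \<le> 0 \<Longrightarrow> u * t \<le> 0"
      using that(2) by (auto simp: mult_nonneg_nonpos)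
    ultimately have "- \<delta> < u * t" "u * t < \<tau> + \<delta>"
      using that(1) \<tau> \<delta>(1) by (auto simp: abs_le_iff abs_if split: if_splits)
    then show ?thesis
      using that(1) by simp
  qed
  have "infinitely_differentiable_on ?U ?K"
    by (intro allI tcd_scaleR[OF U(1) tcd_bounded_linear[OF bounded_linear_snd U(1)]
        tcd_scaled_integral[OF U star continuous_on_const G(1)[rule_format]]])
  moreover have "integral {0..t} (H s) = ?K (s, t)" if "s \<in> ?A" "t \<in> {0..\<tau>}" for s t
  proof -
    have "continuous_on ?U G" using G(1)[rule_format, of 0] by simp
    then have c: "continuous_on {0..t} (\<lambda>u. G (s, u))"
      by (rule continuous_on_compose2) (use that \<delta>(1) in \<open>auto intro!: continuous_intros\<close>)
    have "((\<lambda>u. t *\<^sub>R G (s, t * u)) has_integral integral {t * 0..t * 1} (\<lambda>u. G (s, u))) {0..1}"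
      by (rule has_integral_substitution[where c = 0 and d = t])
        (use c that in \<open>auto intro!: derivative_eq_intros mult_left_le\<close>)
    from integral_unique[OF this] have "integral {0..1} (\<lambda>u. t *\<^sub>R G (s, t * u)) = integral {0..t} (\<lambda>u. G (s, u))"
      by (simp only: mult_zero_right mult_1_right)
    moreover have "integral {0..t} (\<lambda>u. G (s, u)) = integral {0..t} (H s)"
      by (rule integral_cong) (use G(2)[OF that(1)] that(2) in auto)
    ultimately show ?thesis
      by (simp add: mult.commute)
  qed
  ultimately show "smooth_at euclidean_manifold (I \<times> {0..\<tau>}) euclidean_manifold (\<lambda>(s, t). integral {0..t} (H s)) p"
    unfolding smooth_at_euclidean using U(1) st \<delta>(1)
    by (intro conjI exI[of _ ?U] exI[of _ ?K]) (auto simp: case_prod_unfold)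
qed simp

section \<open>Principal actions with a scaling function\<close>

lemma openin_mtop_Times:
  fixes M :: "('p, 'e::euclidean_space) manifold" and N :: "('q, 'f::euclidean_space) manifold"
  assumes M: "compatible_atlas M" and N: "compatible_atlas N"
    and A: "openin (mtop M) A" "A \<subseteq> points M" and C: "openin (mtop N) C" "C \<subseteq> points N"
  shows "openin (mtop (product_manifold M N)) (A \<times> C)"
proof (subst openin_subopen, intro ballI)
  fix p assume "p \<in> A \<times> C"
  then obtain a b where p: "p = (a, b)" "a \<in> A" "b \<in> C" by auto
  obtain U \<phi> where U: "(U, \<phi>) \<in> atlas M" "a \<in> U"
    using A(2) p mem_points by (metis subsetD)
  obtain V \<eta> where V: "(V, \<eta>) \<in> atlas N" "b \<in> V"
    using C(2) p mem_points by (metis subsetD)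
  obtain X where X: "open X" "\<phi> a \<in> X" "\<And>q. q \<in> U \<Longrightarrow> \<phi> q \<in> X \<Longrightarrow> q \<in> A"
    using openin_mtop_chart[OF M U(1) A(1) p(2) U(2)] by blast
  obtain Y where Y: "open Y" "\<eta> b \<in> Y" "\<And>q. q \<in> V \<Longrightarrow> \<eta> q \<in> Y \<Longrightarrow> q \<in> C"
    using openin_mtop_chart[OF N V(1) C(1) p(3) V(2)] by blast
  have "(U \<times> V, map_prod \<phi> \<eta>) \<in> atlas (product_manifold M N)"
    using U V by (auto simp: atlas_product)
  then have "openin (mtop (product_manifold M N)) ((U \<times> V) \<inter> map_prod \<phi> \<eta> -` (X \<times> Y))"
    by (rule openin_mtop_chart_vimage) (intro open_Times X Y)
  moreover have "p \<in> (U \<times> V) \<inter> map_prod \<phi> \<eta> -` (X \<times> Y)" "(U \<times> V) \<inter> map_prod \<phi> \<eta> -` (X \<times> Y) \<subseteq> A \<times> C"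
    using p U V X Y by auto
  ultimately show "\<exists>T. openin (mtop (product_manifold M N)) T \<and> p \<in> T \<and> T \<subseteq> A \<times> C"
    by blast
qed

lemma orbitE:
  assumes "p \<in> orbit \<psi> q"
  obtains \<sigma> where "\<sigma> > 0" "p = \<psi> \<sigma> q"
proof -
  have "\<exists>\<sigma>. p = \<psi> \<sigma> q \<and> \<sigma> > 0"
    using assms unfolding orbit_def mem_Collect_eq .
  then show thesis
    using that by (elim exE conjE)
qed

locale scaled_action =
  fixes Q :: "('q, 'e::euclidean_space) manifold"
    and B :: "('q set, 'f::euclidean_space) manifold"
    and \<psi> :: "real \<Rightarrow> 'q \<Rightarrow> 'q"
    and f :: "'q \<Rightarrow> real"
  assumes Q: "smooth_manifold Q"
    and principal: "principal_action Q \<psi> B"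
    and scaling: "scaling_function Q \<psi> f"
begin

lemma principal_actionD:
  "smooth_action Q \<psi>" "smooth_manifold B" "points B = orbit \<psi> ` points Q"
  "smooth_map_on Q (points Q) B (orbit \<psi>)"
  "b \<in> points B \<Longrightarrow> \<exists>U h. openin (mtop B) U \<and> b \<in> U \<and>
     diffeomorphism_on Q {q \<in> points Q. orbit \<psi> q \<in> U}
       (product_manifold B euclidean_manifold) (U \<times> {0<..}) (\<lambda>q. (orbit \<psi> q, h q :: real))"
proof -
  note p = principal[unfolded principal_action_def]
  show "smooth_action Q \<psi>" "smooth_manifold B" "points B = orbit \<psi> ` points Q"
    "smooth_map_on Q (points Q) B (orbit \<psi>)"
    by (rule p[THEN conjunct1], rule p[THEN conjunct2, THEN conjunct1],
        rule p[THEN conjunct2, THEN conjunct2, THEN conjunct1],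
        rule p[THEN conjunct2, THEN conjunct2, THEN conjunct2, THEN conjunct1])
  assume "b \<in> points B"
  with p show "\<exists>U h. openin (mtop B) U \<and> b \<in> U \<and>
     diffeomorphism_on Q {q \<in> points Q. orbit \<psi> q \<in> U}
       (product_manifold B euclidean_manifold) (U \<times> {0<..}) (\<lambda>q. (orbit \<psi> q, h q :: real))"
    by (elim conjE) (drule (1) bspec, elim exE conjE, intro exI conjI)
qed

lemma compatible: "compatible_atlas Q" "compatible_atlas B"
  "compatible_atlas (product_manifold B euclidean_manifold :: ('q set \<times> real, 'f \<times> real) manifold)"
  by (intro smooth_manifold_imp_compatible_atlas[OF Q] smooth_manifold_imp_compatible_atlas[OF principal_actionD(2)]
      compatible_product compatible_euclidean)+

lemma action:
  assumes "q \<in> points Q"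
  shows "\<sigma> > 0 \<Longrightarrow> \<psi> \<sigma> q \<in> points Q" "\<psi> 1 q = q"
    "\<sigma> > 0 \<Longrightarrow> \<rho> > 0 \<Longrightarrow> \<psi> \<sigma> (\<psi> \<rho> q) = \<psi> (\<sigma> * \<rho>) q"
    "f q > 0" "\<sigma> > 0 \<Longrightarrow> f (\<psi> \<sigma> q) = \<sigma> * f q"
  using principal_actionD(1) scaling assms
  unfolding smooth_action_def scaling_function_def by simp_all

lemma smooth_projection: "q \<in> points Q \<Longrightarrow> smooth_at Q (points Q) B (orbit \<psi>) q"
  using principal_actionD(4) unfolding smooth_map_on_iff_smooth_at[OF compatible(1)] by simp

lemma smooth_scaling: "q \<in> points Q \<Longrightarrow> smooth_at Q (points Q) euclidean_manifold f q"
  using scaling unfolding scaling_function_def smooth_map_on_iff_smooth_at[OF compatible(1)] by simp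

lemma scaling_smooth_near: "q \<in> points Q \<Longrightarrow> f \<in> smooth_near Q q"
  "q \<in> points Q \<Longrightarrow> (\<lambda>q. ln (f q)) \<in> smooth_near Q q"
  using smooth_scaling smooth_near_ln[OF compatible(1), of f q] action(4)
  by (auto simp: smooth_near_iff[OF compatible(1)])

lemma smooth_action_at:
  "\<sigma> > 0 \<Longrightarrow> q \<in> points Q \<Longrightarrow>
     smooth_at (product_manifold euclidean_manifold Q) ({0<..} \<times> points Q) Q (\<lambda>(\<sigma>, q). \<psi> \<sigma> q) (\<sigma>, q)"
  using principal_actionD(1) unfolding smooth_action_def
    smooth_map_on_iff_smooth_at[OF compatible_product[OF compatible_euclidean compatible(1)]] by simp

lemma smooth_translation:
  assumes "\<sigma> > 0" "q \<in> points Q"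
  shows "smooth_at Q (points Q) Q (\<psi> \<sigma>) q"
proof -
  have "smooth_at Q (points Q) Q (\<lambda>q. q) q"
  proof -
    obtain U \<phi> where U: "(U, \<phi>) \<in> atlas Q" "q \<in> U"
      using assms(2) mem_points by metis
    show ?thesis
      unfolding smooth_at_def using assms(2) U compatible_atlasD(2)[OF compatible(1) U(1) U(1) U(2) U(2)]
      by (blast intro: locally_smooth_mono)
  qed
  then have "smooth_at Q (points Q) (product_manifold euclidean_manifold Q) (\<lambda>q. (\<sigma>, q)) q"
    by (intro smooth_at_Pair[OF compatible(1)] smooth_at_const assms(2) order_refl)
  from smooth_at_compose[where F = "\<lambda>q. (\<sigma>, q)" and p = q,
      OF compatible_product[OF compatible_euclidean compatible(1)] this smooth_action_at[OF assms]] assms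
  show ?thesis by simp
qed

lemma orbit_translation:
  assumes "\<sigma> > 0" "q \<in> points Q"
  shows "orbit \<psi> (\<psi> \<sigma> q) = orbit \<psi> q"
proof -
  have "\<psi> \<rho> (\<psi> \<sigma> q) \<in> orbit \<psi> q" if "\<rho> > 0" for \<rho>
    unfolding orbit_def action(3)[OF assms(2) that assms(1)] using that assms(1) by auto
  moreover have "\<psi> \<rho> q \<in> orbit \<psi> (\<psi> \<sigma> q)" if "\<rho> > 0" for \<rho>
  proof -
    have "\<psi> \<rho> q = \<psi> (\<rho> / \<sigma>) (\<psi> \<sigma> q)"
      using action(3)[OF assms(2), of "\<rho> / \<sigma>" \<sigma>] that assms(1) by simp
    then show ?thesis
      unfolding orbit_def using that assms(1) by auto
  qed
  ultimately show ?thesis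
    by (auto simp: orbit_def[of \<psi> q] orbit_def[of \<psi> "\<psi> \<sigma> q"])
qed

section \<open>The global trivialization by the orbit and the scaling function\<close>

lemma inj_orbit_scaling:
  assumes "q \<in> points Q" "p \<in> points Q" "orbit \<psi> p = orbit \<psi> q" "f p = f q"
  shows "p = q"
proof -
  have "p \<in> orbit \<psi> p"
    unfolding orbit_def using action(2)[OF assms(2)] by (metis (mono_tags) mem_Collect_eq zero_less_one)
  then have "p \<in> orbit \<psi> q"
    by (simp only: assms(3))
  then obtain \<sigma> where \<sigma>: "\<sigma> > 0" "p = \<psi> \<sigma> q"
    by (rule orbitE)
  \<comment> \<open>Equivariance gives \<open>f p = \<sigma> * f q\<close>, and \<open>f q\<close>
    is positive and equal to \<open>f p\<close>.\<close>
  then have "\<sigma> = 1"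
    using action(4)[OF assms(1)] action(5)[OF assms(1), of \<sigma>] assms(4) by simp
  then show ?thesis
    using \<sigma> action(2)[OF assms(1)] by simp
qed

definition trivialization_inv :: "'q set \<times> real \<Rightarrow> 'q" where
  "trivialization_inv = inv_into (points Q) (\<lambda>q. (orbit \<psi> q, f q))"

lemma trivialization_inv_eq:
  "q \<in> points Q \<Longrightarrow> trivialization_inv (orbit \<psi> q, f q) = q"
  unfolding trivialization_inv_def
  by (rule inv_into_f_eq) (auto intro!: inj_onI inj_orbit_scaling)

lemma trivialization_inv:
  assumes "b \<in> points B" "r > 0"
  shows "trivialization_inv (b, r) \<in> points Q" "orbit \<psi> (trivialization_inv (b, r)) = b" "f (trivialization_inv (b, r)) = r"
proof -
  obtain q where q: "q \<in> points Q" "b = orbit \<psi> q"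
    using assms(1) unfolding principal_actionD(3) by blast
  \<comment> \<open>Translation by \<open>r / f q\<close> moves \<open>q\<close> along its orbit to
    the point where \<open>f\<close> has the value \<open>r\<close>.\<close>
  define p where "p = \<psi> (r / f q) q"
  have p: "p \<in> points Q" "orbit \<psi> p = b" "f p = r"
    using q action[OF q(1)] orbit_translation[of "r / f q" q] assms(2)
    by (auto simp: p_def)
  have "trivialization_inv (b, r) = p"
    using trivialization_inv_eq[OF p(1)] unfolding p(2,3) .
  with p show "trivialization_inv (b, r) \<in> points Q" "orbit \<psi> (trivialization_inv (b, r)) = b"
    "f (trivialization_inv (b, r)) = r"
    by simp_all
qed

text \<open>In terms of the inverse \<open>i\<close> of a local trivialization, \<open>(\<pi>, f)\<^sup>-\<^sup>1(b, r) = \<psi>(r / f(i(b, r)), i(b, r))\<close>.\<close>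

lemma smooth_trivialization_inv:
  assumes "b \<in> points B" "r > 0"
  shows "smooth_at (product_manifold B euclidean_manifold) (points B \<times> UNIV) Q trivialization_inv (b, r)"
proof -
  let ?P = "product_manifold B euclidean_manifold :: ('q set \<times> real, 'f \<times> real) manifold"
  obtain U h where U: "openin (mtop B) U" "b \<in> U"
    and diffeo: "diffeomorphism_on Q {q \<in> points Q. orbit \<psi> q \<in> U} ?P (U \<times> {0<..}) (\<lambda>q. (orbit \<psi> q, h q :: real))"
    using principal_actionD(5)[OF assms(1)] by blast
  let ?S = "{q \<in> points Q. orbit \<psi> q \<in> U}" and ?T = "U \<times> {0::real<..}"
  define i where "i = inv_into ?S (\<lambda>q. (orbit \<psi> q, h q))"
  have bij: "bij_betw (\<lambda>q. (orbit \<psi> q, h q)) ?S ?T" and i: "smooth_map_on ?P ?T Q i"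
    using diffeo unfolding diffeomorphism_on_def i_def by auto
  have iT: "i p \<in> points Q" "orbit \<psi> (i p) = fst p" if "p \<in> ?T" for p
  proof -
    show "i p \<in> points Q"
      using bij_betw_apply[OF bij_betw_inv_into[OF bij] that] by (simp add: i_def)
    show "orbit \<psi> (i p) = fst p"
      using arg_cong[OF bij_betw_inv_into_right[OF bij that], of fst] unfolding i_def fst_conv .
  qed
  have UB: "U \<subseteq> points B"
  proof
    fix c assume "c \<in> U"
    then have "(c, 1) \<in> ?T" by simp
    then have "(c, 1) \<in> points ?P"
      using i unfolding smooth_map_on_def by blast
    then show "c \<in> points B" by simp
  qed
  have br: "(b, r) \<in> ?T"
    using U(2) assms(2) by simp
  have TP: "?T \<subseteq> points B \<times> points euclidean_manifold"
    using UB by auto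
  have si: "smooth_at ?P ?T Q i (b, r)"
    using i br unfolding smooth_map_on_iff_smooth_at[OF compatible(3)] by blast
  have "smooth_at ?P ?T euclidean_manifold (\<lambda>p. f (i p)) (b, r)"
    by (rule smooth_at_compose[OF compatible(1) si smooth_scaling]) (use iT[OF br] in auto)
  then have "smooth_at ?P ?T euclidean_manifold (\<lambda>p. snd p / f (i p)) (b, r)"
    using smooth_at_divide[OF compatible(3) smooth_at_snd[OF br TP]] action(4)[OF iT(1)[OF br]] by simp
  from smooth_at_compose[OF compatible_product[OF compatible_euclidean compatible(1)]
      smooth_at_Pair[OF compatible(3) this si] smooth_action_at]
  have "smooth_at ?P ?T Q (\<lambda>p. \<psi> (snd p / f (i p)) (i p)) (b, r)"
    using iT action(4) br by force
  moreover have "\<psi> (snd p / f (i p)) (i p) = trivialization_inv p" if "p \<in> ?T" for p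
  proof -
    let ?q = "\<psi> (snd p / f (i p)) (i p)"
    have "snd p > 0" "f (i p) > 0"
      using that action(4)[OF iT(1)[OF that]] by auto
    then have "?q \<in> points Q" "orbit \<psi> ?q = fst p" "f ?q = snd p"
      using action[OF iT(1)[OF that]] orbit_translation[OF _ iT(1)[OF that]] iT(2)[OF that] by auto
    then show ?thesis
      using trivialization_inv_eq[of ?q] by simp
  qed
  ultimately have "smooth_at ?P ?T Q trivialization_inv (b, r)"
    by (rule smooth_at_cong)
  moreover have "(points B \<times> UNIV) \<inter> ?T = ?T"
    using UB by auto
  \<comment> \<open>\<open>velocity_compose\<close> asks for smoothness relative to all points of
    the product, including second components that are not positive, where the values of
    \<open>trivialization_inv\<close> are arbitrary. Openness of \<open>?T\<close> bridges the
    gap.\<close>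
  moreover have "openin (mtop ?P) ?T"
  proof (rule openin_mtop_Times[OF compatible(2) compatible_euclidean U(1) UB])
    show "openin (mtop (euclidean_manifold :: (real, real) manifold)) {0<..}"
      using openin_mtop_chart_vimage[of UNIV id euclidean_manifold "{0::real<..}"] by simp
  qed simp
  ultimately show ?thesis
    using smooth_at_open[OF compatible(3), of "points B \<times> UNIV" ?T] by simp
qed

section \<open>The Lagrangian along curves and the relation between the two functionals\<close>

lemma velocity_projection:
  assumes "c t \<in> points Q"
  shows "velocity B I (\<lambda>s. orbit \<psi> (c s)) t = pushforward Q B (orbit \<psi>) (velocity Q I c t)"
  by (rule velocity_compose[where F = "orbit \<psi>" and c = c, OF compatible(1,2) smooth_projection[OF assms]])

text \<open>With velocities there is no need to show that a derivation ignores the values of a function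
  outside \<open>points Q\<close>, where \<open>f \<circ> \<psi> \<sigma>\<close> and \<open>\<sigma> * f\<close> may differ.\<close>

lemma reduced_lagrangian_velocity:
  assumes l: "reduced_lagrangian Q \<psi> B f L l"
    and c: "\<And>s. s \<in> I \<Longrightarrow> smooth_at euclidean_manifold I Q c s" and t: "t \<in> I" and bot: "at t within I \<noteq> bot"
  shows "L (velocity Q I c t) =
    f (c t) * l (velocity B I (\<lambda>s. orbit \<psi> (c s)) t, differential (\<lambda>q. ln (f q)) (velocity Q I c t))"
proof -
  let ?v = "velocity Q I c t"
  have pts: "c s \<in> points Q" if "s \<in> I" for s
    using smooth_at_points[OF c[OF that]] by blast
  define D where "D = snd ?v f"
  have D: "((\<lambda>s. f (c s)) has_vector_derivative D) (at t within I)"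
    using velocity_differentiable[OF compatible(1) c[OF t] scaling_smooth_near(1)[OF pts[OF t]]]
    by (simp add: D_def comp_def)
  have fpos: "f (c t) > 0"
    using action(4)[OF pts[OF t]] .
  have lnD: "differential (\<lambda>q. ln (f q)) ?v = D / f (c t)"
  proof -
    have "((\<lambda>s. ln (f (c s))) has_vector_derivative D / f (c t)) (at t within I)"
      using D fpos unfolding has_real_derivative_iff_has_vector_derivative[symmetric]
      by (auto intro!: derivative_eq_intros)
    moreover have "((\<lambda>s. ln (f (c s))) has_vector_derivative differential (\<lambda>q. ln (f q)) ?v) (at t within I)"
      using velocity_differentiable[OF compatible(1) c[OF t] scaling_smooth_near(2)[OF pts[OF t]]]
      by (simp add: differential_def comp_def)
    ultimately show ?thesis
      using vector_derivative_unique_within[OF bot] by blast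
  qed
  let ?u = "(velocity B I (\<lambda>s. orbit \<psi> (c s)) t, D / f (c t))"
  \<comment> \<open>A lifted velocity is the velocity of the translated curve. The projection does
    not see the translation, and \<open>\<sigma>\<close> cancels in the quotient of
    \<open>df\<close> by \<open>f\<close>, so all members of the orbit give the same pair and the
    \<open>THE\<close> in \<open>alpha\<close> is well defined.\<close>
  have lift: "(pushforward Q B (orbit \<psi>) w, differential f w / f (fst w)) = ?u"
    if "w = tangent_lift Q \<psi> \<sigma> ?v" "\<sigma> > 0" for w \<sigma>
  proof -
    have w: "w = velocity Q I (\<lambda>s. \<psi> \<sigma> (c s)) t"
      unfolding that(1) tangent_lift_def
      by (rule velocity_compose[symmetric, where F = "\<psi> \<sigma>" and c = c,
            OF compatible(1,1) smooth_translation[OF that(2) pts[OF t]]])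
    have "pushforward Q B (orbit \<psi>) w = velocity B I (\<lambda>s. orbit \<psi> (\<psi> \<sigma> (c s))) t"
      unfolding w by (rule velocity_projection[symmetric]) (rule action(1)[OF pts[OF t] that(2)])
    also have "\<dots> = velocity B I (\<lambda>s. orbit \<psi> (c s)) t"
      by (rule velocity_cong[OF t]) (rule orbit_translation[OF that(2) pts])
    finally have 1: "pushforward Q B (orbit \<psi>) w = velocity B I (\<lambda>s. orbit \<psi> (c s)) t" .
    have "((\<lambda>s. f (\<psi> \<sigma> (c s))) has_vector_derivative \<sigma> * D) (at t within I)"
      by (rule has_vector_derivative_transform[OF t _ has_vector_derivative_mult_right[OF D]])
        (simp add: action(5)[OF pts that(2)])
    then have "vector_derivative (f \<circ> (\<lambda>s. \<psi> \<sigma> (c s))) (at t within I) = \<sigma> * D"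
      using vector_derivative_within[OF bot] by (simp add: comp_def)
    then have "differential f w = \<sigma> * D" "f (fst w) = \<sigma> * f (c t)"
      using scaling_smooth_near(1)[OF action(1)[OF pts[OF t] that(2)]] action(5)[OF pts[OF t] that(2)]
      by (simp_all add: w velocity_def differential_def)
    then show ?thesis
      using 1 that(2) by simp
  qed
  have "alpha Q \<psi> B f (orbit (tangent_lift Q \<psi>) ?v) = ?u"
    unfolding alpha_def
  proof (rule the_equality)
    show "\<forall>w\<in>orbit (tangent_lift Q \<psi>) ?v. ?u = (pushforward Q B (orbit \<psi>) w, differential f w / f (fst w))"
    proof
      fix w assume "w \<in> orbit (tangent_lift Q \<psi>) ?v"
      then obtain \<sigma> where "\<sigma> > 0" "w = tangent_lift Q \<psi> \<sigma> ?v"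
        by (rule orbitE)
      then show "?u = (pushforward Q B (orbit \<psi>) w, differential f w / f (fst w))"
        by (rule lift[symmetric, rotated])
    qed
    fix u assume u: "\<forall>w\<in>orbit (tangent_lift Q \<psi>) ?v. u = (pushforward Q B (orbit \<psi>) w, differential f w / f (fst w))"
    \<comment> \<open>The orbit is nonempty; otherwise every \<open>u\<close> would satisfy the
      condition in the \<open>THE\<close>.\<close>
    have "tangent_lift Q \<psi> 1 ?v \<in> orbit (tangent_lift Q \<psi>) ?v"
      unfolding orbit_def by (intro CollectI exI[of _ 1]) simp
    from bspec[OF u this] show "u = ?u"
      unfolding lift[OF refl zero_less_one] .
  qed
  moreover have "?v \<in> tangent_vectors Q"
    using velocity_in_tangent_space[OF compatible(1) c[OF t] bot] pts[OF t] unfolding tangent_vectors_def by blast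
  then have "l (alpha Q \<psi> B f (orbit (tangent_lift Q \<psi>) ?v)) = L ?v / f (c t)"
    using l unfolding reduced_lagrangian_def by (simp add: velocity_def)
  ultimately have "l ?u = L ?v / f (c t)"
    by simp
  then show ?thesis
    unfolding lnD using fpos by simp
qed

text \<open>Interrelatedness makes \<open>y\<close> the time derivative of
  \<open>ln (f (c t))\<close>, so the first claim is the fundamental theorem of calculus; the second
  is its exponential, with \<open>\<sigma> = f (c 0)\<close>.\<close>

lemma interrelated_integral:
  assumes \<tau>: "\<tau> > 0" and c: "\<And>s. s \<in> {0..\<tau>} \<Longrightarrow> smooth_at euclidean_manifold {0..\<tau>} Q c s"
    and i: "interrelated Q \<psi> f \<tau> c x y \<sigma>" and t: "t \<in> {0..\<tau>}"
  shows "integral {0..t} y = ln (f (c t)) - ln (f (c 0))"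
    and "\<sigma> * exp (integral {0..t} y) = f (c t)"
proof -
  have pts: "c s \<in> points Q" if "s \<in> {0..\<tau>}" for s
    using smooth_at_points[OF c[OF that]] by blast
  have "((\<lambda>s. ln (f (c s))) has_vector_derivative y s) (at s within {0..t})" if "s \<in> {0..t}" for s
  proof -
    have s: "s \<in> {0..\<tau>}" using that t by auto
    have "((\<lambda>s. ln (f (c s))) has_vector_derivative y s) (at s within {0..\<tau>})"
      using velocity_differentiable[OF compatible(1) c[OF s] scaling_smooth_near(2)[OF pts[OF s]]] i s
      by (simp add: interrelated_def differential_def comp_def)
    then show ?thesis
      by (rule has_vector_derivative_within_subset) (use t in auto)
  qed
  then have "(y has_integral (ln (f (c t)) - ln (f (c 0)))) {0..t}"
    by (intro fundamental_theorem_of_calculus) (use t in auto)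
  then show I: "integral {0..t} y = ln (f (c t)) - ln (f (c 0))"
    by (rule integral_unique)
  have "\<sigma> = f (c 0)"
    using i by (simp add: interrelated_def)
  moreover have "f (c 0) > 0" "f (c t) > 0"
    using action(4) pts t \<tau> by auto
  ultimately show "\<sigma> * exp (integral {0..t} y) = f (c t)"
    unfolding I exp_diff by simp
qed

text \<open>Stated for an arbitrary interrelated curve because it is applied to every member of a
  family, where \<open>\<sigma>\<close> may change with the member. The factor
  \<open>f (c t)\<close> in front of the reduced Lagrangian is exactly \<open>\<sigma>\<close> times
  the exponential weight.\<close>

lemma action_functional_eq_reduced:
  assumes l: "reduced_lagrangian Q \<psi> B f L l" and \<tau>: "\<tau> > 0"
    and c: "\<And>s. s \<in> {0..\<tau>} \<Longrightarrow> smooth_at euclidean_manifold {0..\<tau>} Q c s"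
    and i: "interrelated Q \<psi> f \<tau> c x y \<sigma>"
  shows "action_functional Q L \<tau> c = \<sigma> * reduced_functional B l \<tau> x y"
proof -
  have "L (velocity Q {0..\<tau>} c t) = \<sigma> * (exp (integral {0..t} y) * l (velocity B {0..\<tau>} x t, y t))"
    if t: "t \<in> {0..\<tau>}" for t
  proof -
    have "velocity B {0..\<tau>} x t = velocity B {0..\<tau>} (\<lambda>s. orbit \<psi> (c s)) t"
      by (rule velocity_cong[OF t]) (use i in \<open>simp add: interrelated_def\<close>)
    moreover have "y t = differential (\<lambda>q. ln (f q)) (velocity Q {0..\<tau>} c t)"
      using i t by (simp add: interrelated_def)
    ultimately show ?thesis
      using reduced_lagrangian_velocity[OF l c t at_within_Icc_neq_bot[OF \<tau> t]]
        interrelated_integral(2)[OF \<tau> c i t] by (simp add: mult.assoc[symmetric])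
  qed
  then have "action_functional Q L \<tau> c =
      integral {0..\<tau>} (\<lambda>t. \<sigma> * (exp (integral {0..t} y) * l (velocity B {0..\<tau>} x t, y t)))"
    unfolding action_functional_def by (intro integral_cong)
  then show ?thesis
    unfolding reduced_functional_def by simp
qed

end

section \<open>Critical points\<close>

lemma generates_variation_velocity:
  assumes "generates_variation M \<tau> c \<delta>c \<epsilon> \<Gamma>"
  shows "\<epsilon> > 0"
    "smooth_map_on euclidean_manifold ({-\<epsilon><..<\<epsilon>} \<times> {0..\<tau>}) M (\<lambda>(s, t). \<Gamma> s t)"
    "t \<in> {0..\<tau>} \<Longrightarrow> \<Gamma> 0 t = c t"
    "t \<in> {0..\<tau>} \<Longrightarrow> \<delta>c t = velocity M {-\<epsilon><..<\<epsilon>} (\<lambda>s. \<Gamma> s t) 0"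
  using assms unfolding generates_variation_def by simp_all

lemma smooth_map_on_compose_family:
  assumes "compatible_atlas M" "smooth_map_on euclidean_manifold S M (\<lambda>(s::real, t::real). \<Gamma> s t)"
    and "\<And>p. p \<in> T \<Longrightarrow> smooth_at M T N F p" "\<And>s t. (s, t) \<in> S \<Longrightarrow> \<Gamma> s t \<in> T"
  shows "smooth_map_on euclidean_manifold S N (\<lambda>(s, t). F (\<Gamma> s t))"
  unfolding smooth_map_on_iff_smooth_at[OF compatible_euclidean]
proof (intro conjI ballI)
  fix p assume p: "p \<in> S"
  have "smooth_at euclidean_manifold S M (\<lambda>(s, t). \<Gamma> s t) p"
    using assms(2) p unfolding smooth_map_on_iff_smooth_at[OF compatible_euclidean] by blast
  moreover have "smooth_at M T N F (case p of (s, t) \<Rightarrow> \<Gamma> s t)"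
    using assms(3,4) p by (cases p) simp
  ultimately have "smooth_at euclidean_manifold S N (\<lambda>q. F (case q of (s, t) \<Rightarrow> \<Gamma> s t)) p"
    by (rule smooth_at_compose[OF assms(1)]) (use assms(4) in auto)
  then show "smooth_at euclidean_manifold S N (\<lambda>(s, t). F (\<Gamma> s t)) p"
    by (simp add: case_prod_unfold)
qed simp

lemma smooth_map_on_Pair_family:
  assumes "smooth_map_on euclidean_manifold S M (\<lambda>(s::real, t::real). X s t)"
    and "smooth_map_on euclidean_manifold S N (\<lambda>(s, t). Y s t)"
  shows "smooth_map_on euclidean_manifold S (product_manifold M N) (\<lambda>(s, t). (X s t, Y s t))"
  unfolding smooth_map_on_iff_smooth_at[OF compatible_euclidean]
proof (intro conjI ballI)
  fix p assume "p \<in> S"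
  then show "smooth_at euclidean_manifold S (product_manifold M N) (\<lambda>(s, t). (X s t, Y s t)) p"
    using assms smooth_at_Pair[OF compatible_euclidean, of S M "\<lambda>(s, t). X s t" p N "\<lambda>(s, t). Y s t"]
    unfolding smooth_map_on_iff_smooth_at[OF compatible_euclidean] by (simp add: case_prod_unfold)
qed simp

section \<open>The two directions of the equivalence\<close>

context scaled_action
begin

abbreviation base_times_real :: "('q set \<times> real, 'f \<times> real) manifold" where
  "base_times_real \<equiv> product_manifold B euclidean_manifold"

lemma snd_smooth_near: "p \<in> points base_times_real \<Longrightarrow> snd \<in> smooth_near base_times_real p"
  unfolding smooth_near_iff[OF compatible(3)] by (rule smooth_at_snd) simp_all

lemma smooth_fst: "p \<in> points base_times_real \<Longrightarrow> smooth_at base_times_real (points base_times_real) B fst p"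
  by (rule smooth_at_fst) simp_all

text \<open>The zero vector annihilates every function smooth near its base point, here
  \<open>f\<close> and its logarithm.\<close>

lemma has_derivative_scaling_family:
  assumes "smooth_at euclidean_manifold I Q c s" "velocity Q I c s = zero_vector (c s)" "open I" "s \<in> I"
  shows "((\<lambda>s. f (c s)) has_real_derivative 0) (at s)" "((\<lambda>s. ln (f (c s))) has_real_derivative 0) (at s)"
proof -
  have q: "c s \<in> points Q"
    using smooth_at_points[OF assms(1)] by blast
  show "((\<lambda>s. f (c s)) has_real_derivative 0) (at s)" "((\<lambda>s. ln (f (c s))) has_real_derivative 0) (at s)"
    using velocity_differentiable[OF compatible(1) assms(1) scaling_smooth_near(1)[OF q]]
      velocity_differentiable[OF compatible(1) assms(1) scaling_smooth_near(2)[OF q]]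
    unfolding assms(2) zero_vector_def snd_conv at_within_open[OF assms(4,3)]
    by (simp_all add: has_real_derivative_iff_has_vector_derivative comp_def)
qed

definition admissible_variations :: "real \<Rightarrow> (real \<Rightarrow> 'q) \<Rightarrow> (real \<Rightarrow> 'q tangent_vector) set" where
  "admissible_variations \<tau> \<gamma> = {\<delta>\<gamma>. variation Q \<tau> \<gamma> \<delta>\<gamma> \<and>
     \<delta>\<gamma> 0 = zero_vector (\<gamma> 0) \<and> \<delta>\<gamma> \<tau> = zero_vector (\<gamma> \<tau>)}"

definition admissible_reduced_variations ::
  "real \<Rightarrow> (real \<Rightarrow> 'q set) \<Rightarrow> (real \<Rightarrow> real) \<Rightarrow> (real \<Rightarrow> ('q set \<times> real) tangent_vector) set" where
  "admissible_reduced_variations \<tau> x y = {\<delta>c. variation base_times_real \<tau> (\<lambda>t. (x t, y t)) \<delta>c \<and>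
     variation_fst B \<delta>c 0 = zero_vector (x 0) \<and> variation_fst B \<delta>c \<tau> = zero_vector (x \<tau>) \<and>
     integral {0..\<tau>} (variation_snd \<delta>c) = 0}"

lemma critical_if_reduced_critical:
  assumes l: "reduced_lagrangian Q \<psi> B f L l" and \<tau>: "\<tau> > 0"
    and i: "interrelated Q \<psi> f \<tau> \<gamma> x y \<sigma>"
    and crit: "critical_point base_times_real \<tau> (\<lambda>c. reduced_functional B l \<tau> (\<lambda>t. fst (c t)) (\<lambda>t. snd (c t)))
      (\<lambda>t. (x t, y t)) (admissible_reduced_variations \<tau> x y)"
  shows "critical_point Q \<tau> (action_functional Q L \<tau>) \<gamma> (admissible_variations \<tau> \<gamma>)"
  unfolding critical_point_def has_first_variation_def
proof (intro ballI allI impI)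
  fix \<delta>\<gamma> \<epsilon> \<Gamma>
  assume \<delta>\<gamma>: "\<delta>\<gamma> \<in> admissible_variations \<tau> \<gamma>" and gen: "generates_variation Q \<tau> \<gamma> \<delta>\<gamma> \<epsilon> \<Gamma>"
  note \<Gamma> = generates_variation_velocity[OF gen]
  let ?I = "{-\<epsilon><..<\<epsilon>}" and ?T = "{0..\<tau>}"
  have I: "open ?I" "0 \<in> ?I" and T: "0 \<in> ?T" "\<tau> \<in> ?T"
    using \<Gamma>(1) \<tau> by auto
  note slice = smooth_family_slices[OF \<Gamma>(2)]
  have pts: "\<Gamma> s t \<in> points Q" if "s \<in> ?I" "t \<in> ?T" for s t
    using smooth_at_points[OF slice(1)[OF that]] by blast
  have zero: "velocity Q ?I (\<lambda>s. \<Gamma> s t) 0 = zero_vector (\<Gamma> 0 t)" if "t = 0 \<or> t = \<tau>" for t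
    using that \<delta>\<gamma> \<Gamma>(3,4)[of t] T unfolding admissible_variations_def by auto
  define X where "X = (\<lambda>s t. orbit \<psi> (\<Gamma> s t))"
  \<comment> \<open>Chosen to be literally the value of the velocity of \<open>\<Gamma> s\<close> on
    \<open>ln \<circ> f\<close>, so that every slice is interrelated with its projection.\<close>
  define Y where "Y = (\<lambda>s t. vector_derivative (\<lambda>u. ln (f (\<Gamma> s u))) (at t within ?T))"
  have inter: "interrelated Q \<psi> f \<tau> (\<Gamma> s) (X s) (Y s) (f (\<Gamma> s 0))" if s: "s \<in> ?I" for s
    unfolding interrelated_def X_def Y_def differential_def velocity_def
    using scaling_smooth_near(2)[OF pts[OF s]] by (simp add: comp_def)
  have X: "smooth_map_on euclidean_manifold (?I \<times> ?T) B (\<lambda>(s, t). X s t)"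
    unfolding X_def
    by (rule smooth_map_on_compose_family[OF compatible(1) \<Gamma>(2) smooth_projection]) (use pts in auto)
  have "smooth_map_on euclidean_manifold (?I \<times> ?T) euclidean_manifold (\<lambda>(s, t). ln (f (\<Gamma> s t)))"
    by (rule smooth_map_on_compose_family[OF compatible(1) \<Gamma>(2) smooth_at_ln[OF smooth_scaling action(4)]])
      (use pts in auto)
  then have Y: "smooth_map_on euclidean_manifold (?I \<times> ?T) euclidean_manifold (\<lambda>(s, t). Y s t)"
    unfolding Y_def by (rule smooth_on_time_derivative[OF \<tau> I(1)])
  note XY = smooth_map_on_Pair_family[OF X Y]
  have XY0: "(X 0 t, Y 0 t) = (x t, y t)" if t: "t \<in> ?T" for t
  proof -
    have "velocity Q ?T (\<Gamma> 0) t = velocity Q ?T \<gamma> t"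
      by (rule velocity_cong[OF t \<Gamma>(3)])
    moreover have "Y 0 t = differential (\<lambda>q. ln (f q)) (velocity Q ?T (\<Gamma> 0) t)"
      using inter[OF I(2)] t unfolding interrelated_def by blast
    ultimately show ?thesis
      using i t \<Gamma>(3)[OF t] unfolding interrelated_def X_def by auto
  qed
  \<comment> \<open>Whatever variation the projected family generates; its admissibility is checked
    afterwards.\<close>
  define \<delta>c where "\<delta>c = (\<lambda>t. velocity base_times_real ?I (\<lambda>s. (X s t, Y s t)) 0)"
  have gen': "generates_variation base_times_real \<tau> (\<lambda>t. (x t, y t)) \<delta>c \<epsilon> (\<lambda>s t. (X s t, Y s t))"
    unfolding generates_variation_def \<delta>c_def using \<Gamma>(1) XY XY0 by simp
  have PXY: "(X 0 t, Y 0 t) \<in> points base_times_real" if "t \<in> ?T" for t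
    using smooth_at_points[OF smooth_family_slices(1)[OF XY I(2) that]] by blast
  have "variation_fst B \<delta>c t = zero_vector (x t)" if t: "t = 0 \<or> t = \<tau>" for t
  proof -
    have tT: "t \<in> ?T" using t T by auto
    have "variation_fst B \<delta>c t = velocity B ?I (\<lambda>s. fst (X s t, Y s t)) 0"
      unfolding variation_fst_def \<delta>c_def
      by (rule velocity_compose[symmetric, where c = "\<lambda>s. (X s t, Y s t)", OF compatible(3,2) smooth_fst[OF PXY[OF tT]]])
    also have "\<dots> = pushforward Q B (orbit \<psi>) (zero_vector (\<Gamma> 0 t))"
      unfolding fst_conv X_def zero[OF t, symmetric]
      by (rule velocity_projection[where c = "\<lambda>s. \<Gamma> s t"]) (rule pts[OF I(2) tT])
    also have "\<dots> = zero_vector (x t)"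
      using XY0[OF tT] by (simp add: X_def)
    finally show ?thesis .
  qed
  moreover have "integral ?T (variation_snd \<delta>c) = 0"
  proof -
    have "integral ?T (variation_snd \<delta>c) = integral ?T (\<lambda>t. vector_derivative (\<lambda>s. Y s t) (at 0 within ?I))"
    proof (rule integral_cong)
      fix t assume "t \<in> ?T"
      then show "variation_snd \<delta>c t = vector_derivative (\<lambda>s. Y s t) (at 0 within ?I)"
        using snd_smooth_near[OF PXY[of t]]
        unfolding variation_snd_def differential_def \<delta>c_def velocity_def by (simp add: comp_def)
    qed
    \<comment> \<open>The derivative of the integral of \<open>Y s\<close> is computed twice: under
      the integral sign it is the integral of \<delta>y, and through
      \<open>ln (f (\<Gamma> s t))\<close> at the two ends, where the family has zero velocity, it
      is 0.\<close>
    then have "((\<lambda>s. integral ?T (Y s)) has_real_derivative integral ?T (variation_snd \<delta>c)) (at 0)"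
      using smooth_derivative_of_integral[OF \<tau> I Y] by simp
    moreover have "((\<lambda>s. integral ?T (Y s)) has_real_derivative 0) (at 0)"
    proof (rule has_field_derivative_transform_within_open[OF _ I])
      show "((\<lambda>s. ln (f (\<Gamma> s \<tau>)) - ln (f (\<Gamma> s 0))) has_real_derivative 0) (at 0)"
        using DERIV_diff[OF has_derivative_scaling_family(2)[OF slice(1)[OF I(2) T(2)] zero I]
            has_derivative_scaling_family(2)[OF slice(1)[OF I(2) T(1)] zero I]] by simp
      show "ln (f (\<Gamma> s \<tau>)) - ln (f (\<Gamma> s 0)) = integral ?T (Y s)" if "s \<in> ?I" for s
        using interrelated_integral(1)[OF \<tau> slice(2)[OF that] inter[OF that] T(2)] by simp
    qed
    ultimately show ?thesis
      by (rule DERIV_unique)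
  qed
  moreover have "variation base_times_real \<tau> (\<lambda>t. (x t, y t)) \<delta>c"
    unfolding \<delta>c_def by (rule variation_of_smooth_family[OF compatible(3) \<Gamma>(1) XY XY0])
  ultimately have "\<delta>c \<in> admissible_reduced_variations \<tau> x y"
    unfolding admissible_reduced_variations_def by simp
  then have red: "((\<lambda>s. reduced_functional B l \<tau> (X s) (Y s)) has_real_derivative 0) (at 0)"
    using crit gen' unfolding critical_point_def has_first_variation_def by fastforce
  show "((\<lambda>s. action_functional Q L \<tau> (\<Gamma> s)) has_real_derivative 0) (at 0)"
  proof (rule has_field_derivative_transform_within_open[OF _ I])
    show "((\<lambda>s. f (\<Gamma> s 0) * reduced_functional B l \<tau> (X s) (Y s)) has_real_derivative 0) (at 0)"
      using DERIV_mult[OF has_derivative_scaling_family(1)[OF slice(1)[OF I(2) T(1)] zero I] red] by simp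
    show "f (\<Gamma> s 0) * reduced_functional B l \<tau> (X s) (Y s) = action_functional Q L \<tau> (\<Gamma> s)" if "s \<in> ?I" for s
      using action_functional_eq_reduced[OF l \<tau> slice(2)[OF that] inter[OF that]] by simp
  qed
qed

text \<open>A lift is determined up to the initial value of \<open>f\<close>. Keeping that value
  equal to \<open>\<sigma>\<close> for all \<open>s\<close> makes the factor between the functionals
  constant and the \<open>f\<close>-component of the variation at time 0 vanish.\<close>

lemma reduced_critical_if_critical:
  assumes l: "reduced_lagrangian Q \<psi> B f L l" and \<tau>: "\<tau> > 0" and \<sigma>: "\<sigma> > 0"
    and \<gamma>: "\<And>t. t \<in> {0..\<tau>} \<Longrightarrow> smooth_at euclidean_manifold {0..\<tau>} Q \<gamma> t"
    and i: "interrelated Q \<psi> f \<tau> \<gamma> x y \<sigma>"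
    and crit: "critical_point Q \<tau> (action_functional Q L \<tau>) \<gamma> (admissible_variations \<tau> \<gamma>)"
  shows "critical_point base_times_real \<tau> (\<lambda>c. reduced_functional B l \<tau> (\<lambda>t. fst (c t)) (\<lambda>t. snd (c t)))
      (\<lambda>t. (x t, y t)) (admissible_reduced_variations \<tau> x y)"
  unfolding critical_point_def has_first_variation_def
proof (intro ballI allI impI)
  fix \<delta>c \<epsilon> C
  assume \<delta>c: "\<delta>c \<in> admissible_reduced_variations \<tau> x y"
    and gen: "generates_variation base_times_real \<tau> (\<lambda>t. (x t, y t)) \<delta>c \<epsilon> C"
  note C = generates_variation_velocity[OF gen]
  let ?I = "{-\<epsilon><..<\<epsilon>}" and ?T = "{0..\<tau>}"
  have I: "open ?I" "0 \<in> ?I" and T: "0 \<in> ?T" "\<tau> \<in> ?T"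
    using C(1) \<tau> by auto
  define X Y where "X = (\<lambda>s t. fst (C s t))" and "Y = (\<lambda>s t. snd (C s t))"
  have Cpts: "C s t \<in> points base_times_real" if "s \<in> ?I" "t \<in> ?T" for s t
    using smooth_at_points[OF smooth_family_slices(1)[OF C(2) that]] by blast
  have Xpts: "X s t \<in> points B" if "s \<in> ?I" "t \<in> ?T" for s t
    using Cpts[OF that] by (auto simp: X_def)
  have X: "smooth_map_on euclidean_manifold (?I \<times> ?T) B (\<lambda>(s, t). X s t)"
    unfolding X_def
    by (rule smooth_map_on_compose_family[OF compatible(3) C(2) smooth_fst]) (use Cpts in auto)
  have Y: "smooth_map_on euclidean_manifold (?I \<times> ?T) euclidean_manifold (\<lambda>(s, t). Y s t)"
    unfolding Y_def
    by (rule smooth_map_on_compose_family[where T = "points base_times_real", OF compatible(3) C(2) smooth_at_snd])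
      (use Cpts in auto)
  have X0: "X 0 t = x t" and Y0: "Y 0 t = y t" if "t \<in> ?T" for t
    using C(3)[OF that] by (auto simp: X_def Y_def)
  \<comment> \<open>By \<open>interrelated_integral\<close> this is the only possible value of
    \<open>f\<close> along a curve that starts at level \<open>\<sigma>\<close> and is interrelated
    with \<open>X s\<close> and \<open>Y s\<close>.\<close>
  define R where "R = (\<lambda>s t. \<sigma> * exp (integral {0..t} (Y s)))"
  have R: "smooth_map_on euclidean_manifold (?I \<times> ?T) euclidean_manifold (\<lambda>(s, t). R s t)"
  proof -
    have "infinitely_differentiable_on UNIV (\<lambda>z::real. \<sigma> *\<^sub>R exp z)"
      by (intro allI tcd_scaleR tcd_const tcd_exp open_UNIV)
    then have "smooth_at euclidean_manifold UNIV euclidean_manifold (\<lambda>z::real. \<sigma> *\<^sub>R exp z) z" for z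
      by (intro smooth_at_euclideanI[OF open_UNIV UNIV_I])
    from smooth_map_on_compose_family[OF compatible_euclidean smooth_on_integral[OF \<tau> I(1) Y] this]
    show ?thesis
      by (simp add: R_def)
  qed
  have Rpos: "R s t > 0" for s t
    using \<sigma> by (simp add: R_def)
  define \<Gamma> where "\<Gamma> = (\<lambda>s t. trivialization_inv (X s t, R s t))"
  have \<Gamma>: "\<Gamma> s t \<in> points Q" "orbit \<psi> (\<Gamma> s t) = X s t" "f (\<Gamma> s t) = R s t" if "s \<in> ?I" "t \<in> ?T" for s t
    unfolding \<Gamma>_def using trivialization_inv[OF Xpts[OF that] Rpos] by auto
  have triv: "smooth_at base_times_real (points base_times_real) Q trivialization_inv p" if "p \<in> points B \<times> {0<..}" for p
    using that smooth_trivialization_inv by auto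
  have sm: "smooth_map_on euclidean_manifold (?I \<times> ?T) Q (\<lambda>(s, t). \<Gamma> s t)"
    unfolding \<Gamma>_def
  \<comment> \<open>The intermediate domain consists of positive levels, where
    \<open>trivialization_inv\<close> is smooth; \<open>Rpos\<close> places the family inside
    it.\<close>
  proof (rule smooth_map_on_compose_family[where T = "points B \<times> {0<..}", OF compatible(3) smooth_map_on_Pair_family[OF X R]])
    fix p :: "'q set \<times> real" assume p: "p \<in> points B \<times> {0<..}"
    show "smooth_at base_times_real (points B \<times> {0<..}) Q trivialization_inv p"
      by (rule smooth_at_subset[OF triv[OF p] _ p]) auto
  qed (use Xpts Rpos in auto)
  note slice = smooth_family_slices[OF sm]
  have inter: "interrelated Q \<psi> f \<tau> (\<Gamma> s) (X s) (Y s) \<sigma>" if s: "s \<in> ?I" for s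
    unfolding interrelated_def
  proof (intro conjI ballI)
    show "\<sigma> = f (\<Gamma> s 0)"
      using \<Gamma>(3)[OF s T(1)] by (simp add: R_def)
    fix t assume t: "t \<in> ?T"
    show "X s t = orbit \<psi> (\<Gamma> s t)"
      using \<Gamma>(2)[OF s t] by simp
    have "continuous_on ?T (Y s)"
      using smooth_at_euclidean_differentiable[OF smooth_family_slices(2)[OF Y s]] differentiable_imp_continuous_within
      unfolding continuous_on_eq_continuous_within by blast
    then have "((\<lambda>u. integral {0..u} (Y s)) has_vector_derivative Y s t) (at t within ?T)"
      by (rule integral_has_vector_derivative[OF _ t])
    then have "((\<lambda>u. ln \<sigma> + integral {0..u} (Y s)) has_vector_derivative Y s t) (at t within ?T)"
      by (auto intro!: derivative_eq_intros)
    then have "((\<lambda>u. ln (f (\<Gamma> s u))) has_vector_derivative Y s t) (at t within ?T)"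
      by (rule has_vector_derivative_transform[OF t, rotated]) (use \<sigma> in \<open>simp add: \<Gamma>(3)[OF s] R_def ln_mult\<close>)
    from vector_derivative_within[OF at_within_Icc_neq_bot[OF \<tau> t] this]
    show "Y s t = differential (\<lambda>q. ln (f q)) (velocity Q ?T (\<Gamma> s) t)"
      using scaling_smooth_near(2)[OF \<Gamma>(1)[OF s t]] by (simp add: differential_def velocity_def comp_def)
  qed
  \<comment> \<open>At \<open>s = 0\<close> the lift has the same orbit and the same value of
    \<open>f\<close> as \<open>\<gamma> t\<close>, and these two determine the point.\<close>
  have \<Gamma>0: "\<Gamma> 0 t = \<gamma> t" if t: "t \<in> ?T" for t
  proof -
    have "integral {0..t} (Y 0) = integral {0..t} y"
      by (rule integral_cong) (use Y0 t in auto)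
    then have "R 0 t = f (\<gamma> t)"
      using interrelated_integral(2)[OF \<tau> \<gamma> i t] by (simp add: R_def)
    moreover have "X 0 t = orbit \<psi> (\<gamma> t)"
      using i t X0[OF t] by (simp add: interrelated_def)
    moreover have "\<gamma> t \<in> points Q"
      using smooth_at_points[OF \<gamma>[OF t]] by blast
    ultimately show ?thesis
      unfolding \<Gamma>_def using trivialization_inv_eq by simp
  qed
  define \<delta>\<gamma> where "\<delta>\<gamma> = (\<lambda>t. velocity Q ?I (\<lambda>s. \<Gamma> s t) 0)"
  have gen': "generates_variation Q \<tau> \<gamma> \<delta>\<gamma> \<epsilon> \<Gamma>"
    unfolding generates_variation_def \<delta>\<gamma>_def using C(1) sm \<Gamma>0 by simp
  \<comment> \<open>At time 0 the function is the constant \<open>\<sigma>\<close>. At time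
    \<open>\<tau>\<close> its logarithmic derivative is the integral of \<delta>y, which is 0 by
    admissibility.\<close>
  have RT: "((\<lambda>s. R s t) has_vector_derivative 0) (at 0)" if "t = 0 \<or> t = \<tau>" for t
    using that
  proof
    assume "t = \<tau>"
    have "integral ?T (\<lambda>t. vector_derivative (\<lambda>s. Y s t) (at 0 within ?I)) = integral ?T (variation_snd \<delta>c)"
    proof (rule integral_cong)
      fix t assume "t \<in> ?T"
      then show "vector_derivative (\<lambda>s. Y s t) (at 0 within ?I) = variation_snd \<delta>c t"
        using snd_smooth_near[OF Cpts[OF I(2)]] C(4)
        unfolding variation_snd_def differential_def velocity_def Y_def by (simp add: comp_def)
    qed
    also have "\<dots> = 0"
      using \<delta>c by (simp add: admissible_reduced_variations_def)
    finally have "((\<lambda>s. integral ?T (Y s)) has_real_derivative 0) (at 0)"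
      using smooth_derivative_of_integral[OF \<tau> I Y] by simp
    then have "((\<lambda>s. R s \<tau>) has_real_derivative 0) (at 0)"
      unfolding R_def by (auto intro!: derivative_eq_intros)
    then show ?thesis
      using \<open>t = \<tau>\<close> by (simp add: has_real_derivative_iff_has_vector_derivative)
  qed (simp add: R_def)
  \<comment> \<open>The end vector is the pushforward along \<open>trivialization_inv\<close> of a
    velocity in the product. Its components are \<delta>x, zero by admissibility, and the derivative
    of \<open>R\<close>, zero by \<open>RT\<close>.\<close>
  have zero: "\<delta>\<gamma> t = zero_vector (\<gamma> t)" if t: "t = 0 \<or> t = \<tau>" for t
  proof -
    have tT: "t \<in> ?T" using t T by auto
    have "velocity B ?I (\<lambda>s. fst (C s t)) 0 = pushforward base_times_real B fst (velocity base_times_real ?I (\<lambda>s. C s t) 0)"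
      by (rule velocity_compose[where c = "\<lambda>s. C s t", OF compatible(3,2) smooth_fst[OF Cpts[OF I(2) tT]]])
    also have "\<dots> = variation_fst B \<delta>c t"
      unfolding variation_fst_def C(4)[OF tT] ..
    also have "\<dots> = zero_vector (x t)"
      using \<delta>c t unfolding admissible_reduced_variations_def by auto
    finally have "velocity B ?I (\<lambda>s. X s t) 0 = zero_vector (X 0 t)"
      unfolding X0[OF tT] by (simp add: X_def)
    moreover have "((\<lambda>s. R s t) has_vector_derivative 0) (at 0 within ?I)"
      using RT[OF t] by (rule has_vector_derivative_at_within)
    ultimately have "velocity base_times_real ?I (\<lambda>s. (X s t, R s t)) 0 = zero_vector (X 0 t, R 0 t)"
      by (intro velocity_Pair_zero compatible(2) smooth_family_slices(1)[OF X I(2) tT] at_within_open_neq_bot I)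
    then have "\<delta>\<gamma> t = pushforward base_times_real Q trivialization_inv (zero_vector (X 0 t, R 0 t))"
      unfolding \<delta>\<gamma>_def \<Gamma>_def
      using velocity_compose[where c = "\<lambda>s. (X s t, R s t)" and t = 0 and I = ?I, OF compatible(3,1) triv]
        Xpts[OF I(2) tT] Rpos by auto
    then show ?thesis
      using \<Gamma>0[OF tT] by (simp add: \<Gamma>_def)
  qed
  have "variation Q \<tau> \<gamma> \<delta>\<gamma>"
    unfolding \<delta>\<gamma>_def by (rule variation_of_smooth_family[OF compatible(1) C(1) sm \<Gamma>0])
  then have "\<delta>\<gamma> \<in> admissible_variations \<tau> \<gamma>"
    unfolding admissible_variations_def using zero by simp
  then have act: "((\<lambda>s. action_functional Q L \<tau> (\<Gamma> s)) has_real_derivative 0) (at 0)"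
    using crit gen' unfolding critical_point_def has_first_variation_def by blast
  show "((\<lambda>s. reduced_functional B l \<tau> (\<lambda>t. fst (C s t)) (\<lambda>t. snd (C s t))) has_real_derivative 0) (at 0)"
  proof (rule has_field_derivative_transform_within_open[OF _ I])
    show "((\<lambda>s. inverse \<sigma> * action_functional Q L \<tau> (\<Gamma> s)) has_real_derivative 0) (at 0)"
      using DERIV_cmult[OF act] by simp
    show "inverse \<sigma> * action_functional Q L \<tau> (\<Gamma> s) =
        reduced_functional B l \<tau> (\<lambda>t. fst (C s t)) (\<lambda>t. snd (C s t))" if "s \<in> ?I" for s
      using action_functional_eq_reduced[OF l \<tau> slice(2)[OF that] inter[OF that]] \<sigma> by (simp add: X_def Y_def)
  qed
qed

end

theorem theorem8:
  fixes Q :: "('q, 'e::euclidean_space) manifold"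
    and B :: "('q set, 'f::euclidean_space) manifold"
    and \<psi> :: "real \<Rightarrow> 'q \<Rightarrow> 'q"
    and L :: "'q tangent_vector \<Rightarrow> real"
    and f :: "'q \<Rightarrow> real"
    and l :: "'q set tangent_vector \<times> real \<Rightarrow> real"
    and \<gamma> :: "real \<Rightarrow> 'q" and x :: "real \<Rightarrow> 'q set" and y :: "real \<Rightarrow> real"
    and \<tau> \<sigma> :: real
  assumes "smooth_manifold Q"
    and "principal_action Q \<psi> B"
    and "smooth_map_on (tangent_bundle Q) (tangent_vectors Q) euclidean_manifold L"
    and "homogeneous_lagrangian Q \<psi> L"
    and "scaling_function Q \<psi> f"
    and "reduced_lagrangian Q \<psi> B f L l"
    and "\<tau> > 0"
    and "smooth_curve Q \<tau> \<gamma>"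
    and "smooth_curve B \<tau> x"
    and "smooth_curve euclidean_manifold \<tau> y"
    and "\<sigma> > 0"
    and "interrelated Q \<psi> f \<tau> \<gamma> x y \<sigma>"
  shows
    "critical_point Q \<tau> (action_functional Q L \<tau>) \<gamma>
       {\<delta>\<gamma>. variation Q \<tau> \<gamma> \<delta>\<gamma> \<and>
            \<delta>\<gamma> 0 = zero_vector (\<gamma> 0) \<and> \<delta>\<gamma> \<tau> = zero_vector (\<gamma> \<tau>)}
     \<longleftrightarrow>
     critical_point (product_manifold B euclidean_manifold) \<tau>
       (\<lambda>c. reduced_functional B l \<tau> (\<lambda>t. fst (c t)) (\<lambda>t. snd (c t))) (\<lambda>t. (x t, y t))
       {\<delta>c. variation (product_manifold B euclidean_manifold) \<tau> (\<lambda>t. (x t, y t)) \<delta>c \<and>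
            variation_fst B \<delta>c 0 = zero_vector (x 0) \<and> variation_fst B \<delta>c \<tau> = zero_vector (x \<tau>) \<and>
            integral {0..\<tau>} (variation_snd \<delta>c) = 0}"
proof -
  interpret scaled_action Q B \<psi> f
    using assms(1,2,5) by (rule scaled_action.intro)
  have "smooth_at euclidean_manifold {0..\<tau>} Q \<gamma> t" if "t \<in> {0..\<tau>}" for t
    using assms(8) that unfolding smooth_curve_def smooth_map_on_iff_smooth_at[OF compatible_euclidean] by blast
  from reduced_critical_if_critical[OF assms(6,7,11) this assms(12)]
    critical_if_reduced_critical[OF assms(6,7,12)]
  show ?thesis
    unfolding admissible_variations_def admissible_reduced_variations_def by blast
qed

end
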